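(* Let $N\ge1$, $\gamma>0$, $s>\frac N2$, $\beta\in[0,s-\frac N2)$, and let $m$ satisfy condition $(\mathcal H)$. Then there exist two positive constants $A_{s,\beta}$ and $A'_{s,\beta}$ such that for $\alpha\in(1,2)$ and $t\in(0,\infty)$ $$\big\|(-\Delta)^{\frac\beta2}[Q_{\gamma,\alpha}(t,\cdot)-Q_{\gamma,2}(t,\cdot)]\big\|_{H^{-s}}\le A_{s,\beta}(2-\alpha),$$ $$\big\|(-\Delta)^{\frac\beta2}[Q_{\gamma,\alpha}(t,\cdot)-Q_{\gamma,2}(t,\cdot)]\big\|_{H^{-s}}\ge A'_{s,\beta}\,\frac{1}{1+[k_\gamma(t)]^{-1}}\,\frac{(1*m_\gamma)(t)}{1+(1*m_\gamma)(t)}\,(2-\alpha).$$ Especially, one can choose a constant $A''\in(0,A'_{s,\beta})$ such that $$A''(2-\alpha)\le\sup_{t\in(0,\infty)}\|Q_{\gamma,\alpha}(t,\cdot)-Q_{\gamma,2}(t,\cdot)\|_{H^{-s}}\le A_{s,\beta}(2-\alpha).$$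
   Context: Notation: $*$ is convolution in time, $(a*b)(t)=\int_0^t a(t-\tau)b(\tau)\,d\tau$, so $(1*a)(t)=\int_0^ta$; $\mathbb R_+=[0,\infty)$. $(-\Delta)^{\beta/2}$ is the Fourier multiplier with symbol $|\xi|^\beta$. $H^{-s}=H^{-s}(\mathbb R^N)$ has norm $\|u\|_{H^{-s}}^2=\int(1+|\xi|^2)^{-s}|\tilde u(\xi)|^2d\xi$, where $\tilde u$ is the Fourier transform. Put $m_\gamma(t)=1+\gamma m(t)$. Condition $(\mathcal H)$: $m\in L^1_{loc}(\mathbb R_+)$, and there exist a nonnegative and nonincreasing function $k_\gamma\in L^1_{loc}(\mathbb R_+)$ and $\beta_\gamma\ge0$ such that $\beta_\gamma m_\gamma(t)+(k_\gamma*m_\gamma)(t)=1$ for $t>0$. The $k_\gamma$ in the claim is this function; when $k_\gamma(t)=0$, the factor $\frac1{1+[k_\gamma(t)]^{-1}}$ is read as $0$. For $\nu\ge0$, $s_\gamma(\cdot,\nu)$ is the unique solution of $s_\gamma(t,\nu)+\nu(m_\gamma*s_\gamma(\cdot,\nu))(t)=1$, $t\ge0$. For $\alpha\in(1,2]$, $Q_{\gamma,\alpha}(t,\cdot)$ is given by its Fourier transform in $x$: $\tilde Q_{\gamma,\alpha}(t,\xi)=s_\gamma(t,|\xi|^\alpha)$. *)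

theory Defs
  imports "HOL-Analysis.Analysis"
begin

(* L^1_loc on [0,\<infinity>).  Every class has a Borel representative, so integrability with respect to
   lborel is no loss; the notions below do not depend on the representative of m. *)
definition L1_loc :: "(real \<Rightarrow> real) \<Rightarrow> bool" where
  "L1_loc f \<longleftrightarrow> (\<forall>T\<ge>0. set_integrable lborel {0..T} f)"

definition conv :: "(real \<Rightarrow> real) \<Rightarrow> (real \<Rightarrow> real) \<Rightarrow> real \<Rightarrow> real" where
  "conv a b t = (LINT \<tau>:{0..t}|lborel. a (t - \<tau>) * b \<tau>)"

definition m_gamma :: "real \<Rightarrow> (real \<Rightarrow> real) \<Rightarrow> real \<Rightarrow> real" where
  "m_gamma \<gamma> m t = 1 + \<gamma> * m t"

(* k and b are the function k_gamma and the number beta_gamma.  Sign and monotonicity of k are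
   required on (0,\<infinity>) only, since k may blow up at 0 (e.g. k t = t powr (-1/2)).  The identity
   holds for almost every t > 0, m being an element of L^1_loc. *)
definition cond_H :: "real \<Rightarrow> (real \<Rightarrow> real) \<Rightarrow> (real \<Rightarrow> real) \<Rightarrow> real \<Rightarrow> bool" where
  "cond_H \<gamma> m k b \<longleftrightarrow>
     L1_loc m \<and> L1_loc k \<and>
     (\<forall>t>0. 0 \<le> k t) \<and> antimono_on {0<..} k \<and> 0 \<le> b \<and>
     (AE t in lborel. t > 0 \<longrightarrow> b * m_gamma \<gamma> m t + conv k (m_gamma \<gamma> m) t = 1)"

(* The factor 1 / (1 + 1/k), read as 0 at k = 0 (where HOL's inverse would give 1). *)
definition k_factor :: "real \<Rightarrow> real" where
  "k_factor k = (if k = 0 then 0 else 1 / (1 + inverse k))"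

definition volterra_solution :: "(real \<Rightarrow> real) \<Rightarrow> real \<Rightarrow> (real \<Rightarrow> real) \<Rightarrow> bool" where
  "volterra_solution a \<nu> y \<longleftrightarrow>
     continuous_on {0..} y \<and> (\<forall>t\<ge>0. y t + \<nu> * conv a y t = 1)"

(* The values at negative times are normalised only to make the function unique. *)
definition s_gamma :: "real \<Rightarrow> (real \<Rightarrow> real) \<Rightarrow> real \<Rightarrow> real \<Rightarrow> real" where
  "s_gamma \<gamma> m t \<nu> =
     (THE y. volterra_solution (m_gamma \<gamma> m) \<nu> y \<and> (\<forall>t<0. y t = 0)) t"

(* A tempered distribution u on R^N whose Fourier transform is a function is represented by
   that transform, here and below; this is how Q, (-Delta)^(beta/2) and the H^sigma norm are
   given, and none of them depends on the normalisation of the Fourier transform. *)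
type_synonym 'n fourier_side = "real ^ 'n \<Rightarrow> complex"

definition Q_gamma :: "real \<Rightarrow> (real \<Rightarrow> real) \<Rightarrow> real \<Rightarrow> real \<Rightarrow> 'n::finite fourier_side" where
  "Q_gamma \<gamma> m \<alpha> t = (\<lambda>\<xi>. complex_of_real (s_gamma \<gamma> m t (norm \<xi> powr \<alpha>)))"

(* (-Delta)^(beta/2).  For beta = 0 this is the identity off the null set {0}, as 0 powr 0 = 0. *)
definition frac_laplacian :: "real \<Rightarrow> 'n::finite fourier_side \<Rightarrow> 'n fourier_side" where
  "frac_laplacian \<beta> u = (\<lambda>\<xi>. complex_of_real (norm \<xi> powr \<beta>) * u \<xi>)"

(* The value is \<infinity> exactly when u is not in H^sigma. *)
definition sobolev_norm :: "real \<Rightarrow> 'n::finite fourier_side \<Rightarrow> ennreal" where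
  "sobolev_norm \<sigma> u =
     (if u \<in> borel_measurable lborel \<and>
         integrable lborel (\<lambda>\<xi>. (1 + (norm \<xi>)\<^sup>2) powr \<sigma> * (cmod (u \<xi>))\<^sup>2)
      then ennreal (sqrt (LINT \<xi>|lborel. (1 + (norm \<xi>)\<^sup>2) powr \<sigma> * (cmod (u \<xi>))\<^sup>2))
      else \<infinity>)"

end

(* Write a = m_gamma and s(t,nu) for the solution of s + nu a*s = 1. Convolving with
   b delta + k, the inverse of a, turns this into b v + k*v = nu (1*s) for v = 1 - s. A maximum
   principle for the operator v |-> (b v + k*v)' then gives 0 <= s <= 1 and that s is nonincreasing
   in t. For mu <= nu this yields
     (1 - mu/nu) (1 - s(t,nu)) s(t,mu) <= s(t,mu) - s(t,nu) <= (1 - mu/nu) (1 - s(t,nu)).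
   With {mu, nu} = {|xi|^alpha, |xi|^2} the right-hand side is at most (2 - alpha) |ln |xi||, which is
   square integrable for the weight of the norm. The lower bound comes from the shell
   2 <= |xi| <= 3 alone, with s(t,mu) >= k(t) / (k(t) + mu) and 1 - s(t,nu) >= nu A / (1 + nu A) for
   A = (1*a)(t). The bound for the supremum uses one time t with s(t,9) > 0 and s(t,4) < 1, so it
   does not need k(t) > 0. *)

theory Submission imports Defs begin

section \<open>Convolution on the half-line\<close>

text \<open>Every differential inequality is therefore stated for increments of primitives, and
  \<open>conv1_last_max_nonneg\<close> returns to a pointwise one: if 1*q is largest on [0, t] at t,
  then q t >= 0. Formally, s(t,mu) - s(t,nu) is (1 - mu/nu) times the integral of s(t-x,mu) against
  the increasing function 1 - s(x,nu). As s(.,mu) lies between s(t,mu) and 1 on [0, t], this one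
  formula yields both bounds. The identity b a + k*a = 1 holds almost everywhere only; convolved
  with a continuous function it holds at every time. The rules for convolution are therefore proved
  for a continuous last factor. No sign of \<open>a\<close> is assumed: positivity comes from
  \<open>k\<close> through the maximum principle. The shell keeps away from |xi| = 1, where
  |xi|^alpha and |xi|^2 agree and the difference vanishes.\<close>

lemma set_integrable_mult_bounded:
  fixes f g :: "'a \<Rightarrow> real"
  assumes f: "set_integrable M A f" and g: "set_borel_measurable M A g"
    and B: "\<And>x. x \<in> A \<Longrightarrow> \<bar>g x\<bar> \<le> B"
  shows "set_integrable M A (\<lambda>x. f x * g x)"
proof -
  have eq: "indicator A x *\<^sub>R (f x * g x) = (indicator A x *\<^sub>R f x) * (indicator A x *\<^sub>R g x)" for x
    by (simp add: indicator_def)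
  have "integrable M (\<lambda>x. (indicator A x *\<^sub>R f x) * (indicator A x *\<^sub>R g x))"
  proof (rule Bochner_Integration.integrable_bound)
    show "integrable M (\<lambda>x. \<bar>B\<bar> * (indicator A x *\<^sub>R f x))"
      using f unfolding set_integrable_def by (rule integrable_mult_right)
    show "(\<lambda>x. (indicator A x *\<^sub>R f x) * (indicator A x *\<^sub>R g x)) \<in> borel_measurable M"
      using f g unfolding set_integrable_def set_borel_measurable_def by auto
    have "\<bar>f x\<bar> * \<bar>g x\<bar> \<le> \<bar>B\<bar> * \<bar>f x\<bar>" if "x \<in> A" for x
      using mult_left_mono[of "\<bar>g x\<bar>" "\<bar>B\<bar>" "\<bar>f x\<bar>"] B[OF that] by (simp add: mult.commute)
    then show "AE x in M. norm ((indicator A x *\<^sub>R f x) * (indicator A x *\<^sub>R g x))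
        \<le> norm (\<bar>B\<bar> * (indicator A x *\<^sub>R f x))"
      by (intro AE_I2) (simp add: indicator_def abs_mult)
  qed
  then show ?thesis
    unfolding set_integrable_def eq .
qed

lemma set_integrable_continuous:
  fixes f :: "real \<Rightarrow> real"
  shows "continuous_on {a..b} f \<Longrightarrow> set_integrable lborel {a..b} f"
  unfolding set_integrable_def by (rule borel_integrable_compact) auto

lemma L1_loc_continuous: "continuous_on {0..} f \<Longrightarrow> L1_loc f"
  unfolding L1_loc_def
  by (auto intro!: set_integrable_continuous elim: continuous_on_subset)

lemma L1_loc_add: "L1_loc f \<Longrightarrow> L1_loc g \<Longrightarrow> L1_loc (\<lambda>x. f x + g x)"
  and L1_loc_cmult: "L1_loc f \<Longrightarrow> L1_loc (\<lambda>x. c * f x)"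
  unfolding L1_loc_def by auto

lemma L1_loc_diff: "L1_loc f \<Longrightarrow> L1_loc g \<Longrightarrow> L1_loc (\<lambda>x. f x - g x)"
  unfolding L1_loc_def by auto

lemma L1_loc_const: "L1_loc (\<lambda>_. c)"
  by (rule L1_loc_continuous) auto

lemma bounded_continuous:
  fixes f :: "real \<Rightarrow> real"
  assumes "continuous_on {0..t} f"
  obtains B where "B \<ge> 0" "\<And>x. x \<in> {0..t} \<Longrightarrow> \<bar>f x\<bar> \<le> B"
proof -
  have "bounded (f ` {0..t})"
    using assms compact_continuous_image compact_imp_bounded by blast
  then obtain B where "\<forall>x\<in>f ` {0..t}. norm x \<le> B" by (auto simp: bounded_iff)
  then show ?thesis
    by (intro that[of "\<bar>B\<bar>"]) (auto, force)
qed

section \<open>Substitutions on intervals and the elementary rules for convolution\<close>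

lemma set_integrable_reflect:
  fixes f :: "real \<Rightarrow> real"
  shows "set_integrable lborel {a..b} (\<lambda>x. f (c - x)) \<longleftrightarrow> set_integrable lborel {c - b..c - a} f"
proof -
  have "integrable lborel (\<lambda>x. indicator {c - b..c - a} (c + (-1) * x) *\<^sub>R f (c + (-1) * x))
      \<longleftrightarrow> integrable lborel (\<lambda>x. indicator {c - b..c - a} x *\<^sub>R f x)"
    by (rule lborel_integrable_real_affine_iff) simp
  also have "(\<lambda>x. indicator {c - b..c - a} (c + (-1) * x) *\<^sub>R f (c + (-1) * x))
      = (\<lambda>x. indicator {a..b} x *\<^sub>R f (c - x))"
    by (auto simp: fun_eq_iff indicator_def)
  finally show ?thesis unfolding set_integrable_def .
qed

lemma set_integral_reflect:
  fixes f :: "real \<Rightarrow> real"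
  shows "(LINT x:{a..b}|lborel. f (c - x)) = (LINT x:{c - b..c - a}|lborel. f x)"
proof -
  have "(LINT x|lborel. indicator {c - b..c - a} x *\<^sub>R f x)
      = (LINT x|lborel. indicator {c - b..c - a} (c + (-1) * x) *\<^sub>R f (c + (-1) * x))"
    by (subst lborel_integral_real_affine[where c="-1" and t=c]) auto
  also have "(\<lambda>x. indicator {c - b..c - a} (c + (-1) * x) *\<^sub>R f (c + (-1) * x))
      = (\<lambda>x. indicator {a..b} x *\<^sub>R f (c - x))"
    by (auto simp: fun_eq_iff indicator_def)
  finally show ?thesis unfolding set_lebesgue_integral_def by simp
qed

lemma set_integral_shift:
  fixes f :: "real \<Rightarrow> real"
  shows "(LINT x:{a..b}|lborel. f (x - c)) = (LINT x:{a - c..b - c}|lborel. f x)"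
proof -
  have "(LINT x|lborel. indicator {a - c..b - c} x *\<^sub>R f x)
      = (LINT x|lborel. indicator {a - c..b - c} (-c + 1 * x) *\<^sub>R f (-c + 1 * x))"
    by (subst lborel_integral_real_affine[where c="1" and t="-c"]) auto
  also have "(\<lambda>x. indicator {a - c..b - c} (-c + 1 * x) *\<^sub>R f (-c + 1 * x))
      = (\<lambda>x. indicator {a..b} x *\<^sub>R f (x - c))"
    by (auto simp: fun_eq_iff indicator_def)
  finally show ?thesis unfolding set_lebesgue_integral_def by simp
qed

lemma L1_loc_reflect: "L1_loc a \<Longrightarrow> set_integrable lborel {0..t} (\<lambda>\<tau>. a (t - \<tau>))"
  by (cases "t \<ge> 0") (auto simp: set_integrable_reflect L1_loc_def)

lemma conv_commute: "conv a b t = conv b a t"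
  unfolding conv_def using set_integral_reflect[of 0 t "\<lambda>x. a x * b (t - x)" t]
  by (simp add: mult.commute)

text \<open>A continuous factor is bounded, so the convolution integral exists at every t and not
  merely at almost every t. This is what makes the linearity rules below pointwise.\<close>

lemma set_integrable_conv:
  assumes "L1_loc a" "continuous_on {0..t} f"
  shows "set_integrable lborel {0..t} (\<lambda>\<tau>. a (t - \<tau>) * f \<tau>)"
proof -
  obtain B where "\<And>x. x \<in> {0..t} \<Longrightarrow> \<bar>f x\<bar> \<le> B"
    using bounded_continuous[OF assms(2)] by blast
  then show ?thesis
    using assms
    by (intro set_integrable_mult_bounded[where B=B] L1_loc_reflect)
       (auto dest!: set_integrable_continuous
             simp: set_integrable_def set_borel_measurable_def borel_measurable_integrable)
qed

lemma conv_neg: "t < 0 \<Longrightarrow> conv a b t = 0"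
  unfolding conv_def by (simp add: set_lebesgue_integral_def)

lemma conv_0: "conv a b 0 = 0"
proof -
  have "AE x in lborel. x \<in> {0..0::real} \<longrightarrow> a (0-x) * b x = 0"
    using AE_lborel_singleton[of "0::real"] by eventually_elim auto
  then show ?thesis
    unfolding conv_def set_lebesgue_integral_def
    by (intro integral_eq_zero_AE) (auto elim!: eventually_mono simp: indicator_def)
qed

lemma conv_add_right:
  assumes "L1_loc a" "continuous_on {0..t} f" "continuous_on {0..t} g"
  shows "conv a (\<lambda>x. f x + g x) t = conv a f t + conv a g t"
  unfolding conv_def using assms
  by (simp add: distrib_left set_integral_add set_integrable_conv)

lemma conv_diff_right:
  assumes "L1_loc a" "continuous_on {0..t} f" "continuous_on {0..t} g"
  shows "conv a (\<lambda>x. f x - g x) t = conv a f t - conv a g t"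
  unfolding conv_def using assms
  by (simp add: right_diff_distrib set_integral_diff set_integrable_conv)

lemma conv_cmult_right: "conv a (\<lambda>x. c * f x) t = c * conv a f t"
  unfolding conv_def by (simp add: mult.left_commute)

lemma conv_cmult_left: "conv (\<lambda>x. c * a x) f t = c * conv a f t"
  unfolding conv_def by (simp add: mult.assoc)

lemma conv_add_left:
  assumes "L1_loc a" "L1_loc b" "continuous_on {0..t} f"
  shows "conv (\<lambda>x. a x + b x) f t = conv a f t + conv b f t"
  unfolding conv_def using assms
  by (simp add: distrib_right set_integral_add set_integrable_conv)

lemma conv_diff_left:
  assumes "L1_loc a" "L1_loc b" "continuous_on {0..t} f"
  shows "conv (\<lambda>x. a x - b x) f t = conv a f t - conv b f t"
  unfolding conv_def using assms
  by (simp add: left_diff_distrib set_integral_diff set_integrable_conv)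

lemma conv_cong_right:
  "(\<And>x. x \<in> {0..t} \<Longrightarrow> f x = g x) \<Longrightarrow> conv a f t = conv a g t"
  unfolding conv_def by (intro set_lebesgue_integral_cong) auto

lemma conv_abs_le:
  assumes "L1_loc a" "continuous_on {0..t} f" "\<And>x. x \<in> {0..t} \<Longrightarrow> \<bar>f x\<bar> \<le> B"
  shows "\<bar>conv a f t\<bar> \<le> (LINT x:{0..t}|lborel. \<bar>a x\<bar>) * B"
proof -
  have "\<bar>conv a f t\<bar> \<le> (LINT \<tau>:{0..t}|lborel. \<bar>a (t - \<tau>) * f \<tau>\<bar>)"
    unfolding conv_def set_lebesgue_integral_def
    by (rule order_trans[OF integral_abs_bound]) (simp add: abs_mult)
  also have "\<dots> \<le> (LINT \<tau>:{0..t}|lborel. \<bar>a (t - \<tau>)\<bar> * B)"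
  proof (rule set_integral_mono)
    show "set_integrable lborel {0..t} (\<lambda>\<tau>. \<bar>a (t - \<tau>) * f \<tau>\<bar>)"
      by (intro set_integrable_abs set_integrable_conv assms)
    show "set_integrable lborel {0..t} (\<lambda>\<tau>. \<bar>a (t - \<tau>)\<bar> * B)"
      by (intro set_integrable_mult_left set_integrable_abs L1_loc_reflect assms)
  qed (use assms(3) in \<open>auto simp: abs_mult intro!: mult_left_mono\<close>)
  also have "\<dots> = (LINT x:{0..t}|lborel. \<bar>a x\<bar>) * B"
    using set_integral_reflect[of 0 t "\<lambda>x. \<bar>a x\<bar>" t] by simp
  finally show ?thesis .
qed

text \<open>Translation commutes with convolution once \<open>f\<close> vanishes at negative times.
  Differences over a time step rely on it, which is why \<open>U\<close> and \<open>V\<close> below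
  are 0 before time 0.\<close>

lemma conv_shift:
  assumes "\<And>x. x < 0 \<Longrightarrow> f x = 0" "h \<ge> 0"
  shows "conv a (\<lambda>x. f (x - h)) t = conv a f (t - h)"
proof -
  have "conv a (\<lambda>x. f (x - h)) t = (LINT x:{0..t}|lborel. (\<lambda>y. a (t - h - y) * f y) (x - h))"
    unfolding conv_def by (simp add: algebra_simps)
  also have "\<dots> = (LINT x:{0 - h..t - h}|lborel. a (t - h - x) * f x)"
    by (rule set_integral_shift)
  also have "\<dots> = conv a f (t - h)"
    unfolding conv_def set_lebesgue_integral_def
    by (intro Bochner_Integration.integral_cong) (use assms in \<open>auto simp: indicator_def\<close>)
  finally show ?thesis .
qed


section \<open>Fubini for convolutions: local integrability, associativity, continuity\<close>

lemma triple_integrable: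
  fixes F G H :: "real \<Rightarrow> real"
  assumes F: "integrable lborel F" and G: "integrable lborel G"
    and H[measurable]: "H \<in> borel_measurable lborel" and B: "\<And>x. \<bar>H x\<bar> \<le> B"
  shows "integrable (lborel \<Otimes>\<^sub>M lborel) (\<lambda>(x, y). F (t - x) * (G (x - y) * H y))"
proof (rule lborel_pair.Fubini_integrable)
  have [measurable]: "F \<in> borel_measurable borel" "G \<in> borel_measurable borel"
    using F G by auto
  show meas: "(\<lambda>(x, y). F (t - x) * (G (x - y) * H y)) \<in> borel_measurable (lborel \<Otimes>\<^sub>M lborel)"
    by measurable
  have Gi: "integrable lborel (\<lambda>y. G (x - y))" for x
    using lborel_integrable_real_affine[OF G, of "-1" x] by simp
  have Fi: "integrable lborel (\<lambda>y. F (x - y))" for x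
    using lborel_integrable_real_affine[OF F, of "-1" x] by simp
  have GH: "integrable lborel (\<lambda>y. G (x - y) * H y)" for x
  proof (rule Bochner_Integration.integrable_bound)
    show "integrable lborel (\<lambda>y. B * G (x - y))" using Gi by auto
    show "AE y in lborel. norm (G (x - y) * H y) \<le> norm (B * G (x - y))"
      using B order_trans[OF B abs_ge_self] 
      by (intro AE_I2) (simp add: abs_mult mult.commute mult_right_mono)
  qed measurable
  then show "AE x in lborel. integrable lborel (\<lambda>y. case (x, y) of (x, y) \<Rightarrow> F (t - x) * (G (x - y) * H y))"
    by auto
  \<comment> \<open>The inner integral is bounded uniformly in x, so the outer integrand is
    dominated by a multiple of the reflected \<open>F\<close>.\<close>
  have bd: "(LINT y|lborel. \<bar>G (x - y) * H y\<bar>) \<le> (LINT y|lborel. \<bar>G y\<bar>) * B" for x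
  proof -
    have "(LINT y|lborel. \<bar>G (x - y) * H y\<bar>) \<le> (LINT y|lborel. \<bar>G (x - y)\<bar> * B)"
      by (intro integral_mono integrable_abs GH integrable_mult_left Gi)
         (auto simp: abs_mult intro!: mult_left_mono B)
    also have "\<dots> = (LINT y|lborel. \<bar>G y\<bar>) * B"
      using lborel_integral_real_affine[of "-1" "\<lambda>y. \<bar>G y\<bar>" x] by simp
    finally show ?thesis .
  qed
  show "integrable lborel (\<lambda>x. LINT y|lborel. norm (case (x, y) of (x, y) \<Rightarrow> F (t - x) * (G (x - y) * H y)))"
  proof (rule Bochner_Integration.integrable_bound)
    show "integrable lborel (\<lambda>x. F (t - x) * ((LINT y|lborel. \<bar>G y\<bar>) * B))" using Fi by auto
    have "(LINT y|lborel. norm (F (t - x) * (G (x - y) * H y)))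
        = \<bar>F (t - x)\<bar> * (LINT y|lborel. \<bar>G (x - y) * H y\<bar>)" for x
      by (simp add: abs_mult)
    moreover have "\<bar>F (t - x)\<bar> * (LINT y|lborel. \<bar>G (x - y) * H y\<bar>)
        \<le> \<bar>F (t - x)\<bar> * ((LINT y|lborel. \<bar>G y\<bar>) * B)" for x
      by (intro mult_left_mono bd) auto
    moreover have "B \<ge> 0" using order_trans[OF abs_ge_zero B] .
    moreover have "0 \<le> (LINT y|lborel. norm (F (t - x) * (G (x - y) * H y)))" for x
      by (rule Bochner_Integration.integral_nonneg) auto
    ultimately show "AE x in lborel. norm (LINT y|lborel. norm (case (x, y) of (x, y) \<Rightarrow> F (t - x) * (G (x - y) * H y)))
        \<le> norm (F (t - x) * ((LINT y|lborel. \<bar>G y\<bar>) * B))"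
      by (intro AE_I2) (simp add: abs_mult)
  qed measurable
qed

text \<open>Integrating the double integral in x first leaves exactly this integral over the line;
  the substitution x = y + z and the two indicators recover the interval [0, t - y].\<close>

lemma conv_line:
  fixes f g :: "real \<Rightarrow> real"
  assumes "0 \<le> y" "y \<le> t"
  shows "conv f g (t - y) = (LINT x|lborel. (indicator {0..t} (t - x) * f (t - x)) *
      (indicator {0..t} (x - y) * g (x - y)))"
proof -
  have "(LINT x|lborel. (indicator {0..t} (t - x) * f (t - x)) * (indicator {0..t} (x - y) * g (x - y)))
    = (LINT z|lborel. (indicator {0..t} (t - (y + 1 * z)) * f (t - (y + 1 * z))) *
      (indicator {0..t} ((y + 1 * z) - y) * g ((y + 1 * z) - y)))"
    by (subst lborel_integral_real_affine[where c=1 and t=y]) auto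
  also have "\<dots> = (LINT z:{0..t - y}|lborel. f (t - y - z) * g z)"
    unfolding set_lebesgue_integral_def
    by (intro Bochner_Integration.integral_cong)
       (use assms in \<open>auto simp: indicator_def algebra_simps\<close>)
  finally show ?thesis by (simp add: conv_def)
qed

lemma L1_loc_indicator:
  "L1_loc f \<Longrightarrow> integrable lborel (\<lambda>x. indicator {0..t} x * f x)"
  by (cases "t \<ge> 0") (auto simp: L1_loc_def set_integrable_def)

lemma L1_loc_conv:
  assumes f: "L1_loc f" and g: "L1_loc g"
  shows "L1_loc (conv f g)"
  unfolding L1_loc_def
proof safe
  fix t :: real assume "t \<ge> 0"
  define F where "F = (\<lambda>x. indicator {0..t} x * f x)"
  define G where "G = (\<lambda>x. indicator {0..t} x * g x)"
  have "integrable (lborel \<Otimes>\<^sub>M lborel) (\<lambda>(x, y). F (t - x) * (G (x - y) * indicator {0..t} y))"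
    unfolding F_def G_def
    by (rule triple_integrable[where B=1]) (use f g L1_loc_indicator in \<open>auto simp: indicator_def\<close>)
  then have "integrable lborel (\<lambda>y. LINT x|lborel. F (t - x) * (G (x - y) * indicator {0..t} y))"
    by (rule lborel_pair.integrable_snd)
  also have "(\<lambda>y. LINT x|lborel. F (t - x) * (G (x - y) * indicator {0..t} y))
      = (\<lambda>y. indicator {0..t} y *\<^sub>R conv f g (t - y))"
  proof
    fix y
    show "(LINT x|lborel. F (t - x) * (G (x - y) * indicator {0..t} y))
      = indicator {0..t} y *\<^sub>R conv f g (t - y)"
      using conv_line[of y t f g] by (cases "y \<in> {0..t}") (simp_all add: F_def G_def)
  qed
  finally show "set_integrable lborel {0..t} (conv f g)"
    using set_integrable_reflect[of 0 t "conv f g" t] by (simp add: set_integrable_def)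
qed

text \<open>Both sides are iterated integrals of the same function of (x, y): integrating in y first
  gives the left one, in x first the right one.\<close>

lemma conv_assoc:
  assumes f: "L1_loc f" and g: "L1_loc g" and h: "continuous_on {0..t} h"
  shows "conv f (conv g h) t = conv (conv f g) h t"
proof -
  define F where "F = (\<lambda>x. indicator {0..t} x * f x)"
  define G where "G = (\<lambda>x. indicator {0..t} x * g x)"
  define H where "H = (\<lambda>x. indicator {0..t} x * h x)"
  obtain B where B: "B \<ge> 0" "\<And>x. x \<in> {0..t} \<Longrightarrow> \<bar>h x\<bar> \<le> B"
    using bounded_continuous[OF h] by blast
  have "integrable (lborel \<Otimes>\<^sub>M lborel) (\<lambda>(x, y). F (t - x) * (G (x - y) * H y))"
  proof (rule triple_integrable[where B=B])
    show "H \<in> borel_measurable lborel"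
      using set_integrable_continuous[OF h]
      by (simp add: H_def set_integrable_def borel_measurable_integrable)
    show "\<bar>H x\<bar> \<le> B" for x
      using B by (auto simp: H_def indicator_def)
  qed (use f g L1_loc_indicator in \<open>auto simp: F_def G_def\<close>)
  then have "(LINT y|lborel. LINT x|lborel. F (t - x) * (G (x - y) * H y))
      = (LINT x|lborel. LINT y|lborel. F (t - x) * (G (x - y) * H y))"
    by (rule lborel_pair.Fubini_integral)
  also have "\<dots> = conv f (conv g h) t"
    unfolding conv_def[of f] set_lebesgue_integral_def
  proof (rule Bochner_Integration.integral_cong[OF refl])
    fix x
    have "(LINT y|lborel. G (x - y) * H y) = conv g h x" if "0 \<le> x" "x \<le> t"
      unfolding conv_def set_lebesgue_integral_def
      by (intro Bochner_Integration.integral_cong)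
         (use that in \<open>auto simp: G_def H_def indicator_def\<close>)
    then show "(LINT y|lborel. F (t - x) * (G (x - y) * H y))
        = indicator {0..t} x *\<^sub>R (f (t - x) * conv g h x)"
      by (auto simp: F_def indicator_def)
  qed
  also have "(LINT y|lborel. LINT x|lborel. F (t - x) * (G (x - y) * H y)) = conv (conv f g) h t"
    unfolding conv_def[of "conv f g"] set_lebesgue_integral_def
  proof (rule Bochner_Integration.integral_cong[OF refl])
    fix y
    \<comment> \<open>No integrability is claimed for the single y: where the integral diverges,
      both sides take the default value 0.\<close>
    have "(LINT x|lborel. F (t - x) * (G (x - y) * H y)) = (LINT x|lborel. F (t - x) * G (x - y)) * H y"
      by (subst integral_mult_left_zero[symmetric]) (simp add: mult.assoc)
    also have "\<dots> = indicator {0..t} y *\<^sub>R (conv f g (t - y) * h y)"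
      using conv_line[of y t f g] by (cases "y \<in> {0..t}") (simp_all add: F_def G_def H_def)
    finally show "(LINT x|lborel. F (t - x) * (G (x - y) * H y))
        = indicator {0..t} y *\<^sub>R (conv f g (t - y) * h y)" .
  qed
  finally show ?thesis by simp
qed

text \<open>After commuting the factors, the moving argument sits in the continuous one, so
  dominated convergence applies with a multiple of |a| as majorant. The zero extension of
  \<open>f\<close> can jump only at 0, which affects the single point x = t.\<close>

lemma continuous_on_conv:
  assumes a: "L1_loc a" and f: "continuous_on {0..} f"
  shows "continuous_on {0..} (conv a f)"
proof (rule continuous_on_sequentiallyI)
  fix u :: "nat \<Rightarrow> real" and t
  assume u: "\<forall>n. u n \<in> {0..}" and t: "t \<in> {0..}" and lim: "u \<longlonglongrightarrow> t"
  from lim have "bounded (range u)" by (rule convergent_imp_bounded)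
  then obtain T where T: "\<And>n. u n \<le> T"
    by (auto simp: bounded_iff) (meson abs_le_D1)
  have tT: "t \<le> T" using LIMSEQ_le_const2[OF lim] T by blast
  define F where "F = (\<lambda>x. indicator {0..} x * f x)"
  have f': "continuous_on {0..T} f" using f by (rule continuous_on_subset) auto
  obtain B where B: "B \<ge> 0" "\<And>x. x \<in> {0..T} \<Longrightarrow> \<bar>f x\<bar> \<le> B"
    using bounded_continuous[OF f'] by blast
  define A where "A = (\<lambda>x. indicator {0..T} x * a x)"
  have conv_eq: "conv a f r = (LINT x|lborel. A x * F (r - x))" if "r \<le> T" for r
    unfolding conv_commute[of a f r] unfolding conv_def set_lebesgue_integral_def
    by (intro Bochner_Integration.integral_cong) (use that in \<open>auto simp: A_def F_def indicator_def mult.commute\<close>)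
  have [measurable]: "F \<in> borel_measurable borel"
    unfolding F_def using borel_measurable_continuous_on_indicator[of "{0..}" f] f by simp
  have A: "integrable lborel A" unfolding A_def by (rule L1_loc_indicator[OF a])
  then have [measurable]: "A \<in> borel_measurable borel" by auto
  have "(\<lambda>n. LINT x|lborel. A x * F (u n - x)) \<longlonglongrightarrow> (LINT x|lborel. A x * F (t - x))"
  proof (rule integral_dominated_convergence[where w="\<lambda>x. B * \<bar>A x\<bar>"])
    show "integrable lborel (\<lambda>x. B * \<bar>A x\<bar>)" using A by auto
    show "AE x in lborel. norm (A x * F (u n - x)) \<le> B * \<bar>A x\<bar>" for n
    proof (rule AE_I2)
      fix x
      have "x \<in> {0..T} \<Longrightarrow> \<bar>F (u n - x)\<bar> \<le> B"
        using B T[of n] by (auto simp: F_def indicator_def)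
      then show "norm (A x * F (u n - x)) \<le> B * \<bar>A x\<bar>"
        using mult_left_mono[of "\<bar>F (u n - x)\<bar>" B "\<bar>a x\<bar>"]
        by (cases "x \<in> {0..T}") (auto simp: abs_mult A_def mult.commute)
    qed
    show "AE x in lborel. (\<lambda>n. A x * F (u n - x)) \<longlonglongrightarrow> A x * F (t - x)"
      using AE_lborel_singleton[of t]
    proof eventually_elim
      case (elim x)
      have "(\<lambda>n. F (u n - x)) \<longlonglongrightarrow> F (t - x)"
      proof (cases "x < t")
        case True
        have "isCont F (t - x)"
        proof -
          have "continuous_on {0<..} F"
            by (rule continuous_on_eq[where f=f])
              (auto simp: F_def intro: continuous_on_subset[OF f])
          then show ?thesis
            using True by (auto simp: continuous_on_eq_continuous_at)
        qed
        moreover have "(\<lambda>n. u n - x) \<longlonglongrightarrow> t - x" by (intro tendsto_intros lim)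
        ultimately show ?thesis by (rule isCont_tendsto_compose)
      next
        case False
        then have "t < x" using elim by auto
        then have "\<forall>\<^sub>F n in sequentially. u n < x"
          using order_tendstoD(2)[OF lim] by blast
        then have "\<forall>\<^sub>F n in sequentially. F (u n - x) = 0"
          by eventually_elim (auto simp: F_def)
        then show ?thesis
          using \<open>t < x\<close> by (simp add: F_def tendsto_eventually)
      qed
      then show ?case by (intro tendsto_intros)
    qed
  qed measurable
  then show "(\<lambda>n. conv a f (u n)) \<longlonglongrightarrow> conv a f t"
    using T tT by (simp add: conv_eq)
qed


section \<open>The maximum principle\<close>

lemma conv1_integral:
  assumes "continuous_on {0..t} q"
  shows "conv (\<lambda>_. 1) q t = integral {0..t} q"
  unfolding conv_def using set_borel_integral_eq_integral(2)[OF set_integrable_continuous[OF assms]]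
  by simp

lemma conv1_incr:
  assumes "continuous_on {0..t} q" "0 \<le> t'" "t' \<le> t"
  shows "conv (\<lambda>_. 1) q t - conv (\<lambda>_. 1) q t' = integral {t'..t} q"
proof -
  have "continuous_on {0..t'} q" using assms by (auto elim: continuous_on_subset)
  then show ?thesis
    using Henstock_Kurzweil_Integration.integral_combine[of 0 t' t q] assms
    by (simp add: conv1_integral integrable_continuous_real)
qed

lemma conv1_incr_ge:
  assumes "continuous_on {0..t} q" "0 \<le> t'" "t' \<le> t" "\<And>x. x \<in> {t'..t} \<Longrightarrow> c \<le> q x"
  shows "c * (t - t') \<le> conv (\<lambda>_. 1) q t - conv (\<lambda>_. 1) q t'"
proof -
  have "continuous_on {t'..t} q" using assms by (auto elim: continuous_on_subset)
  then have "integral {t'..t} (\<lambda>_. c) \<le> integral {t'..t} q"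
    using assms(4) by (intro integral_le integrable_continuous_real) auto
  then show ?thesis using assms by (simp add: conv1_incr mult.commute)
qed

lemma conv1_incr_le:
  assumes "continuous_on {0..t} q" "0 \<le> t'" "t' \<le> t" "\<And>x. x \<in> {t'..t} \<Longrightarrow> q x \<le> c"
  shows "conv (\<lambda>_. 1) q t - conv (\<lambda>_. 1) q t' \<le> c * (t - t')"
proof -
  have "continuous_on {t'..t} q" using assms by (auto elim: continuous_on_subset)
  then have "integral {t'..t} q \<le> integral {t'..t} (\<lambda>_. c)"
    using assms(4) by (intro integral_le integrable_continuous_real) auto
  then show ?thesis using assms by (simp add: conv1_incr mult.commute)
qed

lemma conv1_const: "t \<ge> 0 \<Longrightarrow> conv (\<lambda>_. 1) (\<lambda>_. 1) t = t"
  by (simp add: conv1_integral)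

lemma continuous_less_near_left:
  fixes q :: "real \<Rightarrow> real"
  assumes "continuous_on {0..t} q" "0 < t" "q t < c"
  obtains d where "0 < d" "d \<le> t" "\<And>x. x \<in> {t - d..t} \<Longrightarrow> q x < c"
proof -
  have "(q \<longlongrightarrow> q t) (at t within {0..t})"
    using assms(1,2) by (auto simp: continuous_on_def)
  then have "\<forall>\<^sub>F x in at t within {0..t}. q x < c"
    using assms(3) by (rule order_tendstoD)
  then obtain e where e: "e > 0" "\<And>x. x \<in> {0..t} \<Longrightarrow> x \<noteq> t \<Longrightarrow> dist x t < e \<Longrightarrow> q x < c"
    by (auto simp: eventually_at)
  show ?thesis
  proof (rule that[of "min t (e/2)"])
    fix x assume x: "x \<in> {t - min t (e/2)..t}"
    have "x \<in> {0..t}" "dist x t < e" using x e assms by (auto simp: dist_real_def)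
    then show "q x < c" using e assms by (cases "x = t") auto
  qed (use e assms in auto)
qed

text \<open>If q t were negative, q would be negative on an interval ending at t, and the primitive
  would decrease there. This is how increment inequalities become pointwise ones.\<close>

lemma conv1_last_max_nonneg:
  assumes q: "continuous_on {0..t} q" and t: "0 < t"
    and le: "\<And>t'. 0 \<le> t' \<Longrightarrow> t' \<le> t \<Longrightarrow> conv (\<lambda>_. 1) q t' \<le> conv (\<lambda>_. 1) q t"
  shows "0 \<le> q t"
proof (rule ccontr)
  assume "\<not> 0 \<le> q t"
  then have "q t < q t / 2" by auto
  then obtain d where d: "0 < d" "d \<le> t" "\<And>x. x \<in> {t - d..t} \<Longrightarrow> q x < q t / 2"
    using continuous_less_near_left[OF q t] by blast
  have "conv (\<lambda>_. 1) q t - conv (\<lambda>_. 1) q (t - d) \<le> q t / 2 * (t - (t - d))"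
    using d by (intro conv1_incr_le q) (auto intro: less_imp_le)
  moreover have "q t / 2 * (t - (t - d)) < 0"
    using \<open>\<not> 0 \<le> q t\<close> d by (simp add: mult_neg_pos)
  moreover have "conv (\<lambda>_. 1) q (t - d) \<le> conv (\<lambda>_. 1) q t" using d by (intro le) auto
  ultimately show False by linarith
qed

text \<open>The kernel is integrated against f (t - x) - f (t' - x), with \<open>f\<close> read as 0
  at negative arguments; this difference is nonnegative by monotonicity and
  \<open>0 \<le> f 0\<close>.\<close>

lemma conv_mono_incr:
  assumes k: "L1_loc \<kappa>" "\<And>x. 0 < x \<Longrightarrow> x \<le> t \<Longrightarrow> 0 \<le> \<kappa> x"
    and f: "continuous_on {0..t} f" "mono_on {0..t} f" "0 \<le> f 0"
    and t: "0 \<le> t'" "t' \<le> t"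
  shows "conv \<kappa> f t' \<le> conv \<kappa> f t"
proof -
  have int: "integrable lborel (\<lambda>x. indicator {0..r} x *\<^sub>R (f (r - x) * \<kappa> x))" if "0 \<le> r" "r \<le> t" for r
  proof -
    have "continuous_on {0..r} f" using f(1) that by (auto elim: continuous_on_subset)
    from set_integrable_conv[OF k(1) this]
    have "set_integrable lborel {0..r} (\<lambda>x. \<kappa> (r - (r - x)) * f (r - x))"
      using set_integrable_reflect[of 0 r "\<lambda>x. \<kappa> (r - x) * f x" r] by simp
    then show ?thesis by (simp add: set_integrable_def mult.commute)
  qed
  show ?thesis
    unfolding conv_commute[of \<kappa> f] unfolding conv_def set_lebesgue_integral_def
  proof (rule integral_mono_AE)
    show "AE x in lborel. indicator {0..t'} x *\<^sub>R (f (t' - x) * \<kappa> x) \<le> indicator {0..t} x *\<^sub>R (f (t - x) * \<kappa> x)"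
      using AE_lborel_singleton[of "0::real"]
    proof eventually_elim
      case (elim x)
      have pos: "0 \<le> f y" if "y \<in> {0..t}" for y
        using f(3) mono_onD[OF f(2), of 0 y] that t by auto
      consider "x \<in> {0<..t'}" | "x \<in> {t'<..t}" "\<not> x \<le> t'" | "x \<notin> {0..t}"
        using elim t by force
      then show ?case
      proof cases
        case 1
        then have "f (t' - x) * \<kappa> x \<le> f (t - x) * \<kappa> x"
          using mono_onD[OF f(2), of "t' - x" "t - x"] k(2)[of x] t by (intro mult_right_mono) auto
        then show ?thesis using 1 t by (auto simp: indicator_def)
      next
        case 2
        then have "0 \<le> f (t - x) * \<kappa> x" using pos[of "t - x"] k(2)[of x] t by auto
        then show ?thesis using 2 by (auto simp: indicator_def)
      qed (use t in \<open>auto simp: indicator_def\<close>)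
    qed
  qed (use int t in auto)
qed

text \<open>Split at t - h. Before it, k (t - x) is at most k (t - h - x), which gives the
  convolution at t - h; on the last strip \<open>p\<close> is at most \<open>e\<close>. The ends of
  the strip are discarded as null sets because \<open>k\<close> is controlled only on the open
  half-line.\<close>

lemma conv_decreasing_kernel_le:
  assumes k: "L1_loc k" "\<And>x. 0 < x \<Longrightarrow> 0 \<le> k x" "antimono_on {0<..} k"
    and p: "continuous_on {0..t} p" "\<And>x. x \<in> {0..t} \<Longrightarrow> 0 \<le> p x"
      "\<And>x. x \<in> {t - h..t} \<Longrightarrow> p x \<le> e"
    and h: "0 < h" "h \<le> t"
  shows "conv k p t \<le> conv k p (t - h) + e * conv k (\<lambda>_. 1) h"
proof -
  have p': "continuous_on {0..t - h} p" using p(1) h by (auto elim: continuous_on_subset)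
  have i1: "integrable lborel (\<lambda>x. indicator {0..t} x *\<^sub>R (k (t - x) * p x))"
    using set_integrable_conv[OF k(1) p(1)] by (simp add: set_integrable_def)
  have i2: "integrable lborel (\<lambda>x. indicator {0..t-h} x *\<^sub>R (k (t - h - x) * p x))"
    using set_integrable_conv[OF k(1) p'] by (simp add: set_integrable_def)
  have "set_integrable lborel {t - h..t} (\<lambda>x. k (t - x))"
    using k(1) h by (simp add: set_integrable_reflect L1_loc_def)
  then have i3: "integrable lborel (\<lambda>x. indicator {t-h..t} x *\<^sub>R (e * k (t - x)))"
    using set_integrable_mult_right[of e] by (auto simp: set_integrable_def)
  have "conv k p t \<le> (LINT x|lborel. indicator {0..t-h} x *\<^sub>R (k (t - h - x) * p x)
      + indicator {t-h..t} x *\<^sub>R (e * k (t - x)))"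
    unfolding conv_def set_lebesgue_integral_def
  proof (rule integral_mono_AE[OF i1 Bochner_Integration.integrable_add[OF i2 i3]])
    show "AE x in lborel. indicator {0..t} x *\<^sub>R (k (t - x) * p x) \<le>
      indicator {0..t-h} x *\<^sub>R (k (t - h - x) * p x) + indicator {t-h..t} x *\<^sub>R (e * k (t - x))"
      using AE_lborel_singleton[of "t - h"] AE_lborel_singleton[of t]
    proof eventually_elim
      case (elim x)
      consider "x \<in> {0..<t-h}" | "x \<in> {t-h<..<t}" | "x \<notin> {0..t}"
        using elim h by force
      then show ?case
      proof cases
        case 1
        then have "k (t - x) * p x \<le> k (t - h - x) * p x"
          using h p(2)[of x] by (intro mult_right_mono monotone_onD[OF k(3)]) auto
        then show ?thesis using 1 h by (auto simp: indicator_def)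
      next
        case 2
        then have "k (t - x) * p x \<le> e * k (t - x)"
          using p(3)[of x] k(2)[of "t - x"] by (auto simp: mult.commute intro!: mult_right_mono)
        then show ?thesis using 2 h by (auto simp: indicator_def)
      qed (use h in \<open>auto simp: indicator_def\<close>)
    qed
  qed
  also have "\<dots> = conv k p (t - h) + e * (LINT x:{t-h..t}|lborel. k (t - x))"
    using i2 i3 by (simp add: conv_def set_lebesgue_integral_def mult.left_commute)
  also have "(LINT x:{t-h..t}|lborel. k (t - x)) = conv k (\<lambda>_. 1) h"
    using set_integral_reflect[of "t-h" t k t] set_integral_reflect[of 0 h k h]
    by (simp add: conv_def)
  finally show ?thesis .
qed

text \<open>At a maximum point \<open>t0\<close> of \<open>w\<close> with \<open>M = w t0\<close>, monotonicity of \<open>k\<close> bounds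
  \<open>k * w\<close> at \<open>t0\<close> minus \<open>k * w\<close> at \<open>t0 - h\<close> from below by \<open>- L h\<close> times the integral of \<open>k\<close> over
  \<open>[0, h]\<close>, which is \<open>o(h)\<close>; the right-hand side would decrease linearly in \<open>h\<close> if \<open>M > c\<close>.\<close>

lemma maximum_principle_Lipschitz:
  assumes k: "L1_loc k" "\<And>x. 0 < x \<Longrightarrow> 0 \<le> k x" "antimono_on {0<..} k"
    and b: "0 \<le> b" and nu: "0 < \<nu>" and c: "0 \<le> c"
    and w: "w 0 = 0" "\<And>x y. x \<in> {0..T} \<Longrightarrow> y \<in> {0..T} \<Longrightarrow> \<bar>w x - w y\<bar> \<le> L * \<bar>x - y\<bar>"
    and eq: "\<And>t. t \<in> {0..T} \<Longrightarrow> b * w t + conv k w t = \<nu> * (H t - conv (\<lambda>_. 1) w t)"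
    and H: "\<And>t t'. 0 \<le> t' \<Longrightarrow> t' \<le> t \<Longrightarrow> t \<le> T \<Longrightarrow> H t - H t' \<le> c * (t - t')"
    and t: "t \<in> {0..T}"
  shows "w t \<le> c"
proof (rule ccontr)
  assume contra: "\<not> w t \<le> c"
  have "t \<noteq> 0" "0 < L * t" using w(2)[of t 0] w(1) contra c t by auto
  then have L: "L \<ge> 0" using t by (auto simp: zero_less_mult_iff)
  have wcont: "continuous_on {0..T} w"
    by (rule lipschitz_on_continuous_on[where L=L], rule lipschitz_onI)
       (use w(2) L in \<open>auto simp: dist_real_def\<close>)
  obtain t0 where t0: "t0 \<in> {0..T}" "\<And>x. x \<in> {0..T} \<Longrightarrow> w x \<le> w t0"
    using continuous_attains_sup[OF _ _ wcont] t by auto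
  define M where "M = w t0"
  have M: "M > c" using t0(2)[OF t] contra by (auto simp: M_def)
  have "t0 > 0" using t0(1) w(1) M c by (cases "t0 = 0") (auto simp: M_def)
  define e where "e = (M - c) / 2"
  have e: "e > 0" using M by (simp add: e_def)
  have cont0: "continuous_on {0..t0} w" using wcont t0(1) by (auto elim: continuous_on_subset)
  have "continuous_on {0..t0} (\<lambda>x. - w x)" using cont0 by (intro continuous_intros)
  moreover have "- w t0 < - (c + e)" using M by (simp add: e_def M_def field_simps)
  ultimately obtain d where d: "0 < d" "d \<le> t0" "\<And>x. x \<in> {t0 - d..t0} \<Longrightarrow> - w x < - (c + e)"
    using continuous_less_near_left[of t0 "\<lambda>x. - w x" "-(c+e)"] \<open>t0 > 0\<close> by blast
  \<comment> \<open>The integral of \<open>k\<close> over [0, h] tends to 0 with h; this choice of h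
    makes the possible loss L h (k*1)(h) smaller than the gain \<nu> e h.\<close>
  have "continuous_on {0..} (conv k (\<lambda>_. 1))" by (rule continuous_on_conv[OF k(1)]) auto
  then have "(conv k (\<lambda>_. 1) \<longlongrightarrow> conv k (\<lambda>_. 1) 0) (at 0 within {0..})"
    by (auto simp: continuous_on_def)
  then have "\<forall>\<^sub>F x in at 0 within {0..}. L * conv k (\<lambda>_. 1) x < \<nu> * e"
    by (intro order_tendstoD(2)[where y="L * conv k (\<lambda>_. 1) 0"] tendsto_intros)
       (use e nu in \<open>auto simp: conv_0\<close>)
  then obtain r where r: "r > 0" "\<And>x. x \<ge> 0 \<Longrightarrow> x \<noteq> 0 \<Longrightarrow> dist x 0 < r \<Longrightarrow> L * conv k (\<lambda>_. 1) x < \<nu> * e"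
    by (auto simp: eventually_at)
  define h where "h = min d (r/2)"
  have h: "0 < h" "h \<le> d" "h \<le> t0" "L * conv k (\<lambda>_. 1) h < \<nu> * e"
    using d r by (auto simp: h_def intro!: r(2))
  have th: "t0 - h \<in> {0..T}" using h t0(1) by auto
  \<comment> \<open>At a maximum point \<open>p\<close> is nonnegative and at most L h on the last
    strip, as the kernel lemma requires. The other part, M (k*1), is nondecreasing since M > c >=
    0.\<close>
  define p where "p = (\<lambda>x. M - w x)"
  have p: "continuous_on {0..t0} p" unfolding p_def by (intro continuous_intros cont0)
  have p_le: "conv k p t0 \<le> conv k p (t0 - h) + (L * h) * conv k (\<lambda>_. 1) h"
  proof (rule conv_decreasing_kernel_le[OF k p])
    show "0 \<le> p x" if "x \<in> {0..t0}" for x using t0 that by (auto simp: p_def M_def)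
    show "p x \<le> L * h" if x: "x \<in> {t0 - h..t0}" for x
    proof -
      have "p x \<le> L * \<bar>t0 - x\<bar>" using w(2)[of t0 x] x h t0(1) by (auto simp: p_def M_def)
      also have "\<dots> \<le> L * h" using x L by (intro mult_left_mono) auto
      finally show ?thesis .
    qed
  qed (use h in auto)
  have kw: "conv k w r = M * conv k (\<lambda>_. 1) r - conv k p r" if "r \<in> {0..t0}" for r
  proof -
    have "continuous_on {0..r} p" using p that by (auto elim: continuous_on_subset)
    then have "conv k (\<lambda>x. M * 1 - p x) r = conv k (\<lambda>x. M * 1) r - conv k p r"
      by (intro conv_diff_right k) auto
    also have "conv k (\<lambda>x. M * 1) r = M * conv k (\<lambda>_. 1) r" by (rule conv_cmult_right)
    finally show ?thesis by (simp add: p_def)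
  qed
  have "conv k (\<lambda>_. 1) (t0 - h) \<le> conv k (\<lambda>_. 1) t0"
    using h k by (intro conv_mono_incr) (auto simp: monotone_on_def)
  then have "M * conv k (\<lambda>_. 1) (t0 - h) \<le> M * conv k (\<lambda>_. 1) t0"
    using M c by (intro mult_left_mono) auto
  then have "conv k w t0 - conv k w (t0 - h) \<ge> - (L * h) * conv k (\<lambda>_. 1) h"
    using kw[of t0] kw[of "t0 - h"] p_le h by auto
  moreover have "b * w (t0 - h) \<le> b * w t0" using t0(2)[OF th] b by (intro mult_left_mono)
  ultimately have "\<nu> * (H t0 - conv (\<lambda>_. 1) w t0) - \<nu> * (H (t0 - h) - conv (\<lambda>_. 1) w (t0 - h))
      \<ge> - (L * h) * conv k (\<lambda>_. 1) h"
    using eq[OF t0(1)] eq[OF th] by linarith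
  moreover have "(c + e) * (t0 - (t0 - h)) \<le> conv (\<lambda>_. 1) w t0 - conv (\<lambda>_. 1) w (t0 - h)"
  proof (intro conv1_incr_ge cont0)
    show "c + e \<le> w x" if "x \<in> {t0 - h..t0}" for x using d(3)[of x] that h by auto
  qed (use h in auto)
  then have "\<nu> * ((c + e) * h) \<le> \<nu> * (conv (\<lambda>_. 1) w t0 - conv (\<lambda>_. 1) w (t0 - h))"
    using nu by (intro mult_left_mono) auto
  moreover have "\<nu> * (H t0 - H (t0 - h)) \<le> \<nu> * (c * h)"
    using nu H[of "t0 - h" t0] h t0(1) by (intro mult_left_mono) auto
  ultimately have "- (L * h) * conv k (\<lambda>_. 1) h \<le> - (\<nu> * e) * h"
    by (simp add: algebra_simps)
  then have "h * (\<nu> * e) \<le> h * (L * conv k (\<lambda>_. 1) h)" by (simp add: algebra_simps)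
  then show False using h by simp
qed

lemma continuous_on_zero_extension:
  fixes f :: "real \<Rightarrow> real"
  assumes "continuous_on {0..} f" "\<And>x. x \<le> 0 \<Longrightarrow> f x = 0"
  shows "continuous_on UNIV f"
proof -
  have "continuous_on {..0} f"
    using continuous_on_cong[of "{..0::real}" "{..0}" f "\<lambda>_. 0"] assms(2) by auto
  then have "continuous_on ({0..} \<union> {..0}) f"
    using assms(1) by (intro continuous_on_closed_Un) auto
  moreover have "{0..} \<union> {..0::real} = UNIV" by auto
  ultimately show ?thesis by simp
qed

text \<open>The Lipschitz assumption is removed by applying the previous lemma to the differences
  \<open>U t - U (t - h)\<close> of the primitive \<open>U = 1 * u\<close>.\<close>

lemma maximum_principle:
  assumes k: "L1_loc k" "\<And>x. 0 < x \<Longrightarrow> 0 \<le> k x" "antimono_on {0<..} k"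
    and b: "0 \<le> b" and nu: "0 < \<nu>" and c: "0 \<le> c"
    and u: "continuous_on {0..} u"
    and eq: "\<And>t. 0 \<le> t \<Longrightarrow> b * u t + conv k u t = \<nu> * (G t - conv (\<lambda>_. 1) u t)"
    and G: "continuous_on UNIV G" "\<And>t. t \<le> 0 \<Longrightarrow> G t = 0"
      "\<And>t t'. t' \<le> t \<Longrightarrow> G t - G t' \<le> c * (t - t')"
    and t: "0 < t"
  shows "u t \<le> c"
proof -
  define U where "U = conv (\<lambda>_. 1) u"
  have u': "continuous_on {0..r} u" for r using u by (auto elim: continuous_on_subset)
  have Un: "U x = 0" if "x \<le> 0" for x
    using that by (cases "x = 0") (auto simp: U_def conv_0 conv_neg)
  have Uc0: "continuous_on {0..} U" unfolding U_def by (intro continuous_on_conv L1_loc_const u)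
  then have Uc: "continuous_on UNIV U" using Un by (rule continuous_on_zero_extension)
  have Uc': "continuous_on S U" for S using Uc by (rule continuous_on_subset) auto
  have Gc': "continuous_on S G" for S using G(1) by (rule continuous_on_subset) auto
  have kuc: "continuous_on {0..r} (conv k u)" for r
    using continuous_on_conv[OF k(1) u] by (auto elim: continuous_on_subset)
  \<comment> \<open>The equation integrated once, with 1*(k*u) rewritten as k*U. It is stated for
    negative r too, where all terms vanish, so that it can be used at r - h.\<close>
  have eqU: "b * U r + conv k U r = \<nu> * (conv (\<lambda>_. 1) G r - conv (\<lambda>_. 1) U r)" for r
  proof (cases "r < 0")
    case True then show ?thesis using Un by (simp add: conv_neg)
  next
    case False
    have "conv (\<lambda>_. 1) (\<lambda>t. b * u t + conv k u t) r = b * U r + conv (\<lambda>_. 1) (conv k u) r"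
      by (subst conv_add_right)
         (auto intro!: L1_loc_const continuous_intros u' kuc simp: conv_cmult_right U_def)
    moreover have "conv (\<lambda>_. 1) (conv k u) r = conv (conv k (\<lambda>_. 1)) u r"
    proof -
      have "conv (\<lambda>_. 1) k = conv k (\<lambda>_. 1)" by (rule ext, rule conv_commute)
      then show ?thesis by (subst conv_assoc) (auto intro!: L1_loc_const k u')
    qed
    moreover have "conv (conv k (\<lambda>_. 1)) u r = conv k U r"
      unfolding U_def by (rule conv_assoc[symmetric]) (auto intro!: L1_loc_const k u')
    moreover have "conv (\<lambda>_. 1) (\<lambda>t. b * u t + conv k u t) r = conv (\<lambda>_. 1) (\<lambda>t. \<nu> * (G t - U t)) r"
      by (rule conv_cong_right) (auto simp: eq U_def)
    moreover have "conv (\<lambda>_. 1) (\<lambda>t. \<nu> * (G t - U t)) r = \<nu> * (conv (\<lambda>_. 1) G r - conv (\<lambda>_. 1) U r)"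
      by (simp add: conv_cmult_right conv_diff_right L1_loc_const Uc' Gc')
    ultimately show ?thesis by simp
  qed
  have shift_cont: "continuous_on S (\<lambda>x. f (x - h))" if "continuous_on UNIV f" for S f and h :: real
    by (rule continuous_on_compose2[OF that]) (auto intro!: continuous_intros)
  have main: "U r - U (r - h) \<le> c * h" if r: "r \<ge> 0" and h: "h > 0" for r h
  proof -
    define w where "w = (\<lambda>x. U x - U (x - h))"
    obtain B where B: "B \<ge> 0" "\<And>x. x \<in> {0..r} \<Longrightarrow> \<bar>u x\<bar> \<le> B"
      using bounded_continuous[OF u'] by blast
    \<comment> \<open>|u| <= B up to time r, and \<open>U\<close> vanishes at negative times; so
      \<open>U\<close> has Lipschitz constant B and its difference \<open>w\<close> has constant 2
      B.\<close>
    have LU0: "\<bar>U y - U x\<bar> \<le> B * (y - x)" if "x \<le> y" "y \<le> r" for x y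
    proof -
      have *: "\<bar>U y - U x\<bar> \<le> B * (y - x)" if "0 \<le> x" "x \<le> y" "y \<le> r" for x y
      proof -
        have "-B \<le> u z" "u z \<le> B" if "z \<in> {x..y}" for z
          using B(2)[of z] \<open>0 \<le> x\<close> \<open>y \<le> r\<close> that by auto
        then show ?thesis
          using conv1_incr_ge[OF u' that(1,2), of "-B"] conv1_incr_le[OF u' that(1,2), of B]
          by (simp add: U_def abs_le_iff)
      qed
      show ?thesis
      proof (cases "0 \<le> x")
        case True then show ?thesis using * that by blast
      next
        case False
        then have "U x = U (max 0 x)" "x \<le> max 0 x" using Un by auto
        moreover have "\<bar>U y - U (max 0 x)\<bar> \<le> B * (y - max 0 x)" if "0 \<le> y"
          using that \<open>y \<le> r\<close> \<open>x \<le> y\<close> by (intro *) auto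
        moreover have "B * (y - max 0 x) \<le> B * (y - x)" using B by (intro mult_left_mono) auto
        moreover have "0 \<le> B * (y - x)" using B that by auto
        ultimately show ?thesis using Un[of y] Un[of x] False by (cases "0 \<le> y") force+
      qed
    qed
    have LU: "\<bar>U x - U y\<bar> \<le> B * \<bar>x - y\<bar>" if "x \<le> r" "y \<le> r" for x y
      using LU0[of x y] LU0[of y x] that by (cases "x \<le> y") (auto simp: abs_minus_commute)
    have "w r \<le> c * h"
    proof (rule maximum_principle_Lipschitz[OF k b nu, where w=w and t=r and c="c * h" and T=r and L="2 * B"
          and H="\<lambda>x. conv (\<lambda>_. 1) G x - conv (\<lambda>_. 1) G (x - h)"])
      show "0 \<le> c * h" using c h by auto
      show "w 0 = 0" using Un h by (simp add: w_def)
      show "\<bar>w x - w y\<bar> \<le> (2 * B) * \<bar>x - y\<bar>" if "x \<in> {0..r}" "y \<in> {0..r}" for x y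
        using LU[of x y] LU[of "x - h" "y - h"] that h by (auto simp: w_def)
      fix x assume "x \<in> {0..r}"
      have cw: "conv f w x = conv f U x - conv f U (x - h)" if "L1_loc f" for f
        unfolding w_def using that conv_shift[of U h f x] Un h
        by (subst conv_diff_right) (auto intro!: Uc' shift_cont Uc)
      have wx: "w x = U x - U (x - h)" by (simp add: w_def)
      show "b * w x + conv k w x =
          \<nu> * ((conv (\<lambda>_. 1) G x - conv (\<lambda>_. 1) G (x - h)) - conv (\<lambda>_. 1) w x)"
        using eqU[of x] eqU[of "x - h"] unfolding cw[OF k(1)] cw[OF L1_loc_const[of 1]] wx
        by (simp add: algebra_simps)
    next
      \<comment> \<open>The source for \<open>w\<close> is the h-difference of 1*G, whose rate of
        growth G z - G (z - h) is at most c h; hence c h takes the place of c.\<close>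
      fix x x' assume x: "0 \<le> x'" "x' \<le> x" "x \<le> r"
      have *: "conv (\<lambda>_. 1) G z - conv (\<lambda>_. 1) G (z - h) = conv (\<lambda>_. 1) (\<lambda>z. G z - G (z - h)) z" for z
        using conv_shift[of G h "\<lambda>_. 1" z] G(2) h
        by (subst conv_diff_right) (auto intro!: L1_loc_const Gc' shift_cont G(1))
      show "conv (\<lambda>_. 1) G x - conv (\<lambda>_. 1) G (x - h) - (conv (\<lambda>_. 1) G x' - conv (\<lambda>_. 1) G (x' - h))
          \<le> c * h * (x - x')"
        unfolding *
      proof (intro conv1_incr_le)
        show "G z - G (z - h) \<le> c * h" for z using G(3)[of "z - h" z] h by simp
      qed (use x in \<open>auto intro!: continuous_intros Gc' shift_cont G(1)\<close>)
    qed (use r in auto)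
    then show ?thesis by (simp add: w_def)
  qed
  \<comment> \<open>\<open>main\<close> says that the primitive of c - u over [0, t] is largest at
    the right end.\<close>
  have "0 \<le> c - u t"
  proof (rule conv1_last_max_nonneg[OF _ t])
    show "continuous_on {0..t} (\<lambda>t. c - u t)" by (intro continuous_intros u')
    fix t' assume t': "0 \<le> t'" "t' \<le> t"
    have cu: "conv (\<lambda>_. 1) (\<lambda>x. c - u x) r = c * r - U r" if "r \<ge> 0" for r
      using conv_diff_right[OF L1_loc_const[of 1] _ u', of r "\<lambda>_. c * 1"] that
      by (simp only: conv_cmult_right U_def conv1_const) (simp add: continuous_on_const)
    show "conv (\<lambda>_. 1) (\<lambda>x. c - u x) t' \<le> conv (\<lambda>_. 1) (\<lambda>x. c - u x) t"
      using main[of t "t - t'"] t' cu[of t] cu[of t'] by (cases "t = t'") (auto simp: algebra_simps)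
  qed
  then show ?thesis by simp
qed


section \<open>Volterra equations\<close>

text \<open>By dominated convergence the weighted mass on [0, T] vanishes as l grows, the point 0
  being null. This makes the Volterra operator a contraction for every \<nu> and T.\<close>

lemma exponential_weight_small:
  assumes a: "L1_loc a" and e: "0 < e"
  obtains l where "(LINT x:{0..T}|lborel. \<bar>exp (- l * x) * a x\<bar>) \<le> e"
proof -
  define A where "A = (\<lambda>x. indicator {0..T} x * a x)"
  have A: "integrable lborel A" unfolding A_def by (rule L1_loc_indicator[OF a])
  then have [measurable]: "A \<in> borel_measurable borel" by auto
  have "(\<lambda>n. LINT x|lborel. \<bar>exp (- real n * x) * A x\<bar>) \<longlonglongrightarrow> (LINT x|(lborel::real measure). 0)"
  proof (rule integral_dominated_convergence[where w="\<lambda>x. \<bar>A x\<bar>"])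
    show "AE x in lborel. norm \<bar>exp (- real n * x) * A x\<bar> \<le> \<bar>A x\<bar>" for n
    proof (rule AE_I2)
      fix x
      show "norm \<bar>exp (- real n * x) * A x\<bar> \<le> \<bar>A x\<bar>"
        by (cases "x \<ge> 0") (auto simp: abs_mult A_def indicator_def intro!: mult_left_le_one_le)
    qed
    show "AE x in lborel. (\<lambda>n. \<bar>exp (- real n * x) * A x\<bar>) \<longlonglongrightarrow> 0"
      using AE_lborel_singleton[of "0::real"]
    proof eventually_elim
      case (elim x)
      show ?case
      proof (cases "x > 0")
        case True
        have "(\<lambda>n. exp (- x) ^ n) \<longlonglongrightarrow> 0"
          using True by (intro LIMSEQ_realpow_zero) auto
        then have "(\<lambda>n. exp (- real n * x)) \<longlonglongrightarrow> 0"
          by (simp add: exp_of_nat_mult[symmetric])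
        then have "(\<lambda>n. \<bar>exp (- real n * x) * A x\<bar>) \<longlonglongrightarrow> \<bar>0 * A x\<bar>"
          by (intro tendsto_intros)
        then show ?thesis by simp
      qed (use elim in \<open>simp add: A_def\<close>)
    qed
  qed (use A in auto)
  then have "\<forall>\<^sub>F n in sequentially. (LINT x|lborel. \<bar>exp (- real n * x) * A x\<bar>) < e"
    using e by (intro order_tendstoD(2)) auto
  then obtain n where "(LINT x|lborel. \<bar>exp (- real n * x) * A x\<bar>) < e"
    by (auto simp: eventually_sequentially)
  moreover have "(LINT x|lborel. \<bar>exp (- real n * x) * A x\<bar>)
      = (LINT x:{0..T}|lborel. \<bar>exp (- real n * x) * a x\<bar>)"
    unfolding set_lebesgue_integral_def
    by (intro Bochner_Integration.integral_cong) (auto simp: A_def indicator_def)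
  ultimately show ?thesis by (intro that[of "real n"]) simp
qed

lemma L1_loc_exp_mult:
  assumes "L1_loc a" shows "L1_loc (\<lambda>x. exp (l * x) * a x)"
  unfolding L1_loc_def
proof safe
  fix T :: real assume T: "T \<ge> 0"
  have c: "continuous_on {0..T} (\<lambda>x. exp (l * x))" by (intro continuous_intros)
  obtain B where "\<And>x. x \<in> {0..T} \<Longrightarrow> \<bar>exp (l * x)\<bar> \<le> B" using bounded_continuous[OF c] by metis
  then have "set_integrable lborel {0..T} (\<lambda>x. a x * exp (l * x))"
    using assms T set_integrable_continuous[OF c]
    by (intro set_integrable_mult_bounded[where B=B])
       (auto simp: L1_loc_def set_integrable_def set_borel_measurable_def)
  then show "set_integrable lborel {0..T} (\<lambda>x. exp (l * x) * a x)" by (simp add: mult.commute)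
qed

text \<open>Exponentials are multiplicative, so a weight on both factors is the same weight on the
  convolution.\<close>

lemma conv_exp_weight:
  "conv (\<lambda>x. exp (l * x) * a x) (\<lambda>x. exp (l * x) * f x) t = exp (l * t) * conv a f t"
proof -
  have "exp (l * (t - x)) * a (t - x) * (exp (l * x) * f x) = exp (l * t) * (a (t - x) * f x)" for x
  proof -
    have "exp (l * t) = exp (l * (t - x)) * exp (l * x)" by (simp add: exp_add[symmetric] algebra_simps)
    then show ?thesis by simp
  qed
  then show ?thesis unfolding conv_def by (simp only: set_integral_mult_right)
qed

lemma set_integral_abs_mono:
  assumes "L1_loc a" "r \<le> T"
  shows "(LINT x:{0..r}|lborel. \<bar>a x :: real\<bar>) \<le> (LINT x:{0..T}|lborel. \<bar>a x\<bar>)"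
  unfolding set_lebesgue_integral_def
proof (rule integral_mono)
  have "integrable lborel (\<lambda>x. indicator {0..s} x *\<^sub>R \<bar>a x\<bar>)" for s :: real
    using integrable_abs[OF L1_loc_indicator[OF assms(1), of s]] by (simp add: abs_mult)
  from this[of r] this[of T] show "integrable lborel (\<lambda>x. indicator {0..r} x *\<^sub>R \<bar>a x\<bar>)"
    "integrable lborel (\<lambda>x. indicator {0..T} x *\<^sub>R \<bar>a x\<bar>)" .
qed (use assms in \<open>auto simp: indicator_def\<close>)

text \<open>The weighted difference of two solutions is at most half of its own maximum. The bound 1
  / (2 (|\<nu>| + 1)) on the mass gives the factor 1/2 and avoids a division by zero at \<nu> =
  0.\<close>

lemma volterra_unique_upto:
  assumes a: "L1_loc a"
    and y: "continuous_on {0..T} y" "\<And>t. t \<in> {0..T} \<Longrightarrow> y t + \<nu> * conv a y t = 1"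
    and z: "continuous_on {0..T} z" "\<And>t. t \<in> {0..T} \<Longrightarrow> z t + \<nu> * conv a z t = 1"
    and t: "t \<in> {0..T}"
  shows "y t = z t"
proof -
  define d where "d = (\<lambda>x. y x - z x)"
  have d: "continuous_on {0..T} d" unfolding d_def by (intro continuous_intros y z)
  have dc: "continuous_on {0..r} f" if "r \<in> {0..T}" "continuous_on {0..T} f" for r and f :: "real \<Rightarrow> real"
    using that(1) by (intro continuous_on_subset[OF that(2)]) auto
  have d_eq: "d r = - \<nu> * conv a d r" if "r \<in> {0..T}" for r
  proof -
    have "conv a d r = conv a y r - conv a z r"
      unfolding d_def by (intro conv_diff_right a dc[OF that] y(1) z(1))
    then show ?thesis
      using y(2)[OF that] z(2)[OF that] by (simp add: d_def right_diff_distrib)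
  qed
  obtain l where l: "(LINT x:{0..T}|lborel. \<bar>exp (- l * x) * a x\<bar>) \<le> 1 / (2 * (\<bar>\<nu>\<bar> + 1))"
    by (rule exponential_weight_small[OF a, of "1 / (2 * (\<bar>\<nu>\<bar> + 1))" T]) auto
  define K where "K = (\<lambda>x. exp (- l * x) * a x)"
  define g where "g = (\<lambda>x. exp (- l * x) * d x)"
  have K: "L1_loc K" unfolding K_def by (rule L1_loc_exp_mult[OF a])
  have g: "continuous_on {0..T} g" unfolding g_def by (intro continuous_intros d)
  have g_eq: "g r = - \<nu> * conv K g r" if "r \<in> {0..T}" for r
    unfolding K_def conv_exp_weight g_def using d_eq[OF that] by simp
  have "\<exists>x\<in>{0..T}. \<forall>y\<in>{0..T}. \<bar>g y\<bar> \<le> \<bar>g x\<bar>"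
    by (rule continuous_attains_sup[OF compact_Icc _ continuous_on_rabs[OF g]]) (use t in auto)
  then obtain t0 where t0: "t0 \<in> {0..T}" "\<And>x. x \<in> {0..T} \<Longrightarrow> \<bar>g x\<bar> \<le> \<bar>g t0\<bar>"
    by blast
  have "\<bar>conv K g t0\<bar> \<le> (LINT x:{0..t0}|lborel. \<bar>K x\<bar>) * \<bar>g t0\<bar>"
  proof (rule conv_abs_le[OF K dc[OF t0(1) g]])
    show "\<bar>g x\<bar> \<le> \<bar>g t0\<bar>" if "x \<in> {0..t0}" for x using that t0(1) by (intro t0(2)) simp
  qed
  also have "\<dots> \<le> 1 / (2 * (\<bar>\<nu>\<bar> + 1)) * \<bar>g t0\<bar>"
  proof (rule mult_right_mono)
    have "(LINT x:{0..t0}|lborel. \<bar>K x\<bar>) \<le> (LINT x:{0..T}|lborel. \<bar>K x\<bar>)"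
      using t0(1) by (intro set_integral_abs_mono[OF K]) simp
    then show "(LINT x:{0..t0}|lborel. \<bar>K x\<bar>) \<le> 1 / (2 * (\<bar>\<nu>\<bar> + 1))"
      using l unfolding K_def by (rule order_trans)
  qed simp
  finally have "\<bar>\<nu>\<bar> * \<bar>conv K g t0\<bar> \<le> \<bar>\<nu>\<bar> * (1 / (2 * (\<bar>\<nu>\<bar> + 1)) * \<bar>g t0\<bar>)"
    by (intro mult_left_mono) auto
  also have "\<dots> = (\<bar>\<nu>\<bar> / (2 * (\<bar>\<nu>\<bar> + 1))) * \<bar>g t0\<bar>" by simp
  also have "\<dots> \<le> 1 / 2 * \<bar>g t0\<bar>"
    by (intro mult_right_mono) (auto simp: field_simps)
  finally have "\<bar>g t0\<bar> \<le> 1 / 2 * \<bar>g t0\<bar>"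
    using g_eq[OF t0(1)] by (simp add: abs_mult)
  then have "g t = 0" using t0(2)[OF t] by linarith
  then show ?thesis by (simp add: g_def d_def)
qed

text \<open>Banach's fixed point theorem for the weighted unknown exp (- l t) y t among bounded
  continuous functions. Cutting the kernel off at T keeps its weighted mass small at all times, at
  the price of an equation valid on [0, T] only.\<close>

lemma volterra_exists_upto:
  assumes a: "L1_loc a" and T: "0 \<le> T"
  obtains y where "continuous_on {0..} y" "\<And>t. t \<in> {0..T} \<Longrightarrow> y t + \<nu> * conv a y t = 1"
proof -
  obtain l where l: "(LINT x:{0..T}|lborel. \<bar>exp (- l * x) * a x\<bar>) \<le> 1 / (2 * (\<bar>\<nu>\<bar> + 1))"
    by (rule exponential_weight_small[OF a, of "1 / (2 * (\<bar>\<nu>\<bar> + 1))" T]) auto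
  define A where "A = (\<lambda>x. indicator {0..T} x * a x)"
  define K where "K = (\<lambda>x. exp (- l * x) * A x)"
  have A_int: "integrable lborel A" unfolding A_def by (rule L1_loc_indicator[OF a])
  then have A: "L1_loc A"
    using integrable_mult_indicator[OF _ A_int] by (auto simp: L1_loc_def set_integrable_def)
  have K: "L1_loc K" unfolding K_def by (rule L1_loc_exp_mult[OF A])
  have K_le: "(LINT x:{0..r}|lborel. \<bar>K x\<bar>) \<le> 1 / (2 * (\<bar>\<nu>\<bar> + 1))" for r
  proof -
    have "(LINT x:{0..r}|lborel. \<bar>K x\<bar>) \<le> (LINT x:{0..max r T}|lborel. \<bar>K x\<bar>)"
      by (rule set_integral_abs_mono[OF K]) auto
    also have "\<dots> = (LINT x:{0..T}|lborel. \<bar>exp (- l * x) * a x\<bar>)"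
      unfolding set_lebesgue_integral_def
      by (intro Bochner_Integration.integral_cong) (auto simp: K_def A_def indicator_def)
    finally show ?thesis using l by simp
  qed
  \<comment> \<open>\<open>max\<close> and \<open>min\<close> extend the weighted equation from
    [0, T] to the whole line with a bounded exponential, so that \<Phi> z is again bounded and
    continuous.\<close>
  define \<Phi> where "\<Phi> = (\<lambda>(z :: real \<Rightarrow>\<^sub>C real) t.
    exp (- l * min (max t 0) T) - \<nu> * conv K z (max t 0))"
  have cK: "\<bar>conv K f r\<bar> \<le> 1 / (2 * (\<bar>\<nu>\<bar> + 1)) * B"
    if "continuous_on UNIV f" "\<And>x. \<bar>f x\<bar> \<le> B" for f B r
  proof -
    have "\<bar>conv K f r\<bar> \<le> (LINT x:{0..r}|lborel. \<bar>K x\<bar>) * B"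
      using that by (intro conv_abs_le K) (auto elim: continuous_on_subset)
    also have "\<dots> \<le> 1 / (2 * (\<bar>\<nu>\<bar> + 1)) * B"
      using order_trans[OF abs_ge_zero that(2)] by (intro mult_right_mono K_le) 
    finally show ?thesis .
  qed
  have nu: "\<bar>\<nu>\<bar> * (1 / (2 * (\<bar>\<nu>\<bar> + 1)) * B) \<le> 1 / 2 * B" if "B \<ge> 0" for B
  proof -
    have "\<bar>\<nu>\<bar> * (1 / (2 * (\<bar>\<nu>\<bar> + 1)) * B) = (\<bar>\<nu>\<bar> / (2 * (\<bar>\<nu>\<bar> + 1))) * B" by simp
    also have "\<dots> \<le> 1 / 2 * B" using that by (intro mult_right_mono) (auto simp: field_simps)
    finally show ?thesis .
  qed
  have \<Phi>: "\<Phi> z \<in> bcontfun" for z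
  proof (rule bcontfun_normI)
    have "continuous_on {0..} (conv K z)" by (intro continuous_on_conv K) auto
    then have "continuous_on UNIV (\<lambda>t. conv K z (max t 0))"
      by (rule continuous_on_compose2) (auto intro!: continuous_intros)
    then show "continuous_on UNIV (\<Phi> z)"
      unfolding \<Phi>_def by (intro continuous_intros)
    show "norm (\<Phi> z t) \<le> exp (\<bar>l\<bar> * T) + 1 / 2 * norm z" for t
    proof -
      have "\<bar>conv K z (max t 0)\<bar> \<le> 1 / (2 * (\<bar>\<nu>\<bar> + 1)) * norm z"
        using norm_bounded[of z] by (intro cK) auto
      then have "\<bar>\<nu>\<bar> * \<bar>conv K z (max t 0)\<bar> \<le> \<bar>\<nu>\<bar> * (1 / (2 * (\<bar>\<nu>\<bar> + 1)) * norm z)"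
        by (intro mult_left_mono) auto
      also note nu[of "norm z"]
      finally have "\<bar>\<nu> * conv K z (max t 0)\<bar> \<le> 1 / 2 * norm z" by (simp add: abs_mult)
      moreover have "- l * min (max t 0) T \<le> \<bar>l\<bar> * T"
      proof -
        have "- l * min (max t 0) T \<le> \<bar>l\<bar> * min (max t 0) T"
          using T by (intro mult_right_mono) auto
        also have "\<dots> \<le> \<bar>l\<bar> * T" by (intro mult_left_mono) auto
        finally show ?thesis .
      qed
      then have "exp (- l * min (max t 0) T) \<le> exp (\<bar>l\<bar> * T)" by simp
      ultimately show ?thesis
        unfolding \<Phi>_def real_norm_def using exp_ge_zero[of "- l * min (max t 0) T"] by linarith
    qed
  qed
  have "\<exists>!z. Bcontfun (\<Phi> z) = z"
  proof (rule banach_fix_type[where c="1/2"])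
    show "\<forall>x y. dist (Bcontfun (\<Phi> x)) (Bcontfun (\<Phi> y)) \<le> 1 / 2 * dist x y"
    proof (intro allI dist_bound)
      fix x y :: "real \<Rightarrow>\<^sub>C real" and t
      have "conv K (\<lambda>t. x t - y t) (max t 0) = conv K x (max t 0) - conv K y (max t 0)"
        by (rule conv_diff_right) (auto intro: K)
      then have "\<Phi> x t - \<Phi> y t = - (\<nu> * conv K (\<lambda>t. x t - y t) (max t 0))"
        by (simp add: \<Phi>_def right_diff_distrib)
      then have "dist (\<Phi> x t) (\<Phi> y t) = \<bar>\<nu>\<bar> * \<bar>conv K (\<lambda>t. x t - y t) (max t 0)\<bar>"
        by (simp only: dist_real_def abs_minus_cancel abs_mult)
      also have "\<dots> \<le> \<bar>\<nu>\<bar> * (1 / (2 * (\<bar>\<nu>\<bar> + 1)) * dist x y)"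
        using dist_bounded[of x _ y]
        by (intro mult_left_mono cK) (auto intro!: continuous_intros simp: dist_real_def)
      also have "\<dots> \<le> 1 / 2 * dist x y" by (rule nu) simp
      finally show "dist (Bcontfun (\<Phi> x) t) (Bcontfun (\<Phi> y) t) \<le> 1 / 2 * dist x y"
        by (simp add: Bcontfun_inverse \<Phi>)
    qed
  qed auto
  then obtain z where "Bcontfun (\<Phi> z) = z" by blast
  then have z: "z t = \<Phi> z t" for t using Bcontfun_inverse[OF \<Phi>, of z] by metis
  define y where "y = (\<lambda>t. exp (l * t) * z t)"
  show ?thesis
  proof (rule that[of y])
    show "continuous_on {0..} y" unfolding y_def by (intro continuous_intros) auto
    fix t assume t: "t \<in> {0..T}"
    have zy: "apply_bcontfun z = (\<lambda>x. exp (- l * x) * y x)"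
      unfolding y_def mult.assoc[symmetric] exp_add[symmetric] by simp
    have "z t = exp (- l * t) - \<nu> * conv K z t"
      using z[of t] t by (simp add: \<Phi>_def)
    also have "conv K z t = exp (- l * t) * conv A y t"
      unfolding zy K_def by (rule conv_exp_weight)
    also have "conv A y t = conv a y t"
      unfolding conv_def set_lebesgue_integral_def
      by (intro Bochner_Integration.integral_cong) (use t in \<open>auto simp: A_def indicator_def\<close>)
    finally have "exp (- l * t) * (y t + \<nu> * conv a y t) = exp (- l * t) * 1"
      unfolding fun_cong[OF zy, of t] by (simp add: distrib_left)
    then show "y t + \<nu> * conv a y t = 1" by (simp only: mult_cancel_left exp_not_eq_zero simp_thms)
  qed
qed

text \<open>The weight depends on T, so a solution is built for each T; uniqueness makes them agree,
  and Y t t glues them. Continuity at t is read off from the solution up to t + 1.\<close>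

lemma volterra_solution_ex1:
  assumes a: "L1_loc a"
  shows "\<exists>!y. volterra_solution a \<nu> y \<and> (\<forall>t<0. y t = 0)"
proof -
  have "\<exists>y. continuous_on {0..} y \<and> (\<forall>t\<in>{0..T}. y t + \<nu> * conv a y t = 1)" if "T \<ge> 0" for T
    by (rule volterra_exists_upto[OF a that, of \<nu>]) blast
  then obtain Y where Y: "\<And>T. T \<ge> 0 \<Longrightarrow> continuous_on {0..} (Y T)"
    "\<And>T t. T \<ge> 0 \<Longrightarrow> t \<in> {0..T} \<Longrightarrow> Y T t + \<nu> * conv a (Y T) t = 1"
    using choice[of "\<lambda>T y. T \<ge> 0 \<longrightarrow> continuous_on {0..} y \<and> (\<forall>t\<in>{0..T}. y t + \<nu> * conv a y t = 1)"]
    by blast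
  have Yc: "continuous_on {0..r} (Y T)" if "T \<ge> 0" for r T
    using Y(1)[OF that] by (auto elim: continuous_on_subset)
  define y where "y = (\<lambda>t. if t < 0 then 0 else Y t t)"
  have yY: "y t = Y T t" if "0 \<le> t" "t \<le> T" for t T
  proof -
    have "Y t t = Y T t"
      by (rule volterra_unique_upto[OF a, where T=t and \<nu>=\<nu>]) (use that Yc Y(2) in auto)
    then show ?thesis using that by (simp add: y_def)
  qed
  have "continuous_on {0..} y"
    unfolding continuous_on_eq_continuous_within
  proof
    fix t :: real assume t: "t \<in> {0..}"
    have "continuous (at t within {0..}) (Y (t + 1))"
      using Y(1)[of "t + 1"] t by (auto simp: continuous_on_eq_continuous_within)
    then show "continuous (at t within {0..}) y"
    proof (rule continuous_transform_within[where \<delta>=1])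
      show "Y (t + 1) x = y x" if "x \<in> {0..}" "dist x t < 1" for x
        using yY[of x "t + 1"] that by (auto simp: dist_real_def)
    qed (use t in auto)
  qed
  moreover have "y t + \<nu> * conv a y t = 1" if "t \<ge> 0" for t
  proof -
    have "conv a y t = conv a (Y t) t" by (rule conv_cong_right) (use yY in auto)
    moreover have "Y t t + \<nu> * conv a (Y t) t = 1" using Y(2)[of t t] that by simp
    moreover have "y t = Y t t" using yY[of t t] that by simp
    ultimately show ?thesis by (simp only:)
  qed
  ultimately have ex: "volterra_solution a \<nu> y \<and> (\<forall>t<0. y t = 0)"
    by (auto simp: volterra_solution_def y_def)
  show ?thesis
  proof (rule ex1I[where a=y])
    show "volterra_solution a \<nu> y \<and> (\<forall>t<0. y t = 0)" by (rule ex)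
    fix z assume z: "volterra_solution a \<nu> z \<and> (\<forall>t<0. z t = 0)"
    show "z = y"
    proof
      fix t
      show "z t = y t"
      proof (cases "t < 0")
        case False
        have sol: "continuous_on {0..t} f \<and> (\<forall>r\<in>{0..t}. f r + \<nu> * conv a f r = 1)"
          if "volterra_solution a \<nu> f" for f
          using that by (auto simp: volterra_solution_def elim: continuous_on_subset)
        show ?thesis
          by (rule volterra_unique_upto[OF a, where T=t and \<nu>=\<nu>])
             (use sol[OF conjunct1[OF z]] sol[OF conjunct1[OF ex]] False in \<open>simp_all del: atLeastAtMost_iff, simp\<close>)
      next
        case True
        then show ?thesis using z ex by metis
      qed
    qed
  qed
qed

lemma L1_loc_m_gamma: "L1_loc m \<Longrightarrow> L1_loc (m_gamma \<gamma> m)"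
  unfolding m_gamma_def by (intro L1_loc_add L1_loc_const L1_loc_cmult)

lemma volterra_solution_s_gamma:
  assumes "L1_loc m"
  shows "volterra_solution (m_gamma \<gamma> m) \<nu> (\<lambda>t. s_gamma \<gamma> m t \<nu>)"
  using theI'[OF volterra_solution_ex1[OF L1_loc_m_gamma[OF assms], of \<gamma> \<nu>]]
  unfolding s_gamma_def by blast


section \<open>Solutions for completely positive kernels\<close>

text \<open>Turns identities valid almost everywhere, such as the one in condition (H), into
  equalities at every time.\<close>

lemma conv_cong_AE_left:
  assumes f: "L1_loc f" "L1_loc f'" and g: "continuous_on {0..t} g"
    and eq: "AE x in lborel. 0 < x \<longrightarrow> f x = f' x"
  shows "conv f g t = conv f' g t"
proof -
  have int: "integrable lborel (\<lambda>x. indicator {0..t} x *\<^sub>R (g (t - x) * h x))" if "L1_loc h" for h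
    using set_integrable_conv[OF that g] set_integrable_reflect[of 0 t "\<lambda>x. h (t - x) * g x" t]
    by (simp add: set_integrable_def mult.commute)
  show ?thesis
    unfolding conv_commute[of f g] conv_commute[of f' g]
    unfolding conv_def set_lebesgue_integral_def
  proof (rule integral_cong_AE)
    show "AE x in lborel. indicator {0..t} x *\<^sub>R (g (t - x) * f x)
        = indicator {0..t} x *\<^sub>R (g (t - x) * f' x)"
      using eq AE_lborel_singleton[of "0::real"]
      by eventually_elim (auto simp: indicator_def)
  qed (use int[OF f(1)] int[OF f(2)] in auto)
qed

text \<open>\<open>a\<close> stands for \<open>m_gamma \<gamma> m\<close>, a completely positive
  kernel. The parameter of \<open>S\<close> comes first so that \<open>S \<nu>\<close> is a function
  of time that \<open>conv\<close> accepts.\<close>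

locale volterra_family =
  fixes a k :: "real \<Rightarrow> real" and b :: real and S :: "real \<Rightarrow> real \<Rightarrow> real"
  assumes a: "L1_loc a"
    and k: "L1_loc k" "\<And>x. 0 < x \<Longrightarrow> 0 \<le> k x" "antimono_on {0<..} k"
    and b: "0 \<le> b"
    and pair: "AE t in lborel. 0 < t \<longrightarrow> b * a t + conv k a t = 1"
    and S: "\<And>\<nu>. 0 \<le> \<nu> \<Longrightarrow> volterra_solution a \<nu> (S \<nu>)"
begin

abbreviation A :: "real \<Rightarrow> real" where "A \<equiv> conv (\<lambda>_. 1) a"

lemma S_continuous: "0 \<le> \<nu> \<Longrightarrow> continuous_on {0..} (S \<nu>)"
  and S_eq: "0 \<le> \<nu> \<Longrightarrow> 0 \<le> t \<Longrightarrow> S \<nu> t + \<nu> * conv a (S \<nu>) t = 1"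
  using S unfolding volterra_solution_def by auto

lemma S_continuous': "0 \<le> \<nu> \<Longrightarrow> continuous_on {0..t} (S \<nu>)"
  using S_continuous by (rule continuous_on_subset) auto

lemma S_at_0: "0 \<le> \<nu> \<Longrightarrow> S \<nu> 0 = 1"
  using S_eq[of \<nu> 0] by (simp add: conv_0)

lemma S_zero: "0 \<le> t \<Longrightarrow> S 0 t = 1"
  using S_eq[of 0 t] by simp

text \<open>The complement of the solution, extended by 0 continuously since \<open>S \<nu>\<close>
  starts at 1. It is the unknown of the maximum principle and may be shifted in time.\<close>

definition V :: "real \<Rightarrow> real \<Rightarrow> real" where
  "V \<nu> t = (if t \<le> 0 then 0 else 1 - S \<nu> t)"

lemma V_eq_S: "0 \<le> \<nu> \<Longrightarrow> 0 \<le> t \<Longrightarrow> V \<nu> t = 1 - S \<nu> t"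
  using S_at_0 by (cases "t = 0") (auto simp: V_def)

lemma V_continuous: "0 \<le> \<nu> \<Longrightarrow> continuous_on X (V \<nu>)"
proof -
  assume nu: "0 \<le> \<nu>"
  have "continuous_on {0..} (\<lambda>t. 1 - S \<nu> t)"
    by (intro continuous_intros S_continuous nu)
  then have "continuous_on {0..} (V \<nu>)"
    using nu by (subst continuous_on_cong[OF refl, of _ _ "\<lambda>t. 1 - S \<nu> t"]) (auto simp: V_eq_S)
  then have "continuous_on UNIV (V \<nu>)"
    by (rule continuous_on_zero_extension) (simp add: V_def)
  then show ?thesis by (rule continuous_on_subset) auto
qed

lemma conv1_S:
  assumes "0 \<le> \<nu>" "0 \<le> t"
  shows "conv (\<lambda>_. 1) (S \<nu>) t = t - conv (\<lambda>_. 1) (V \<nu>) t"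
proof -
  have "conv (\<lambda>_. 1) (S \<nu>) t = conv (\<lambda>_. 1) (\<lambda>x. 1 - V \<nu> x) t"
    by (rule conv_cong_right) (auto simp: V_eq_S assms)
  also have "\<dots> = t - conv (\<lambda>_. 1) (V \<nu>) t"
    using assms by (subst conv_diff_right) (auto intro: L1_loc_const V_continuous simp: conv1_const)
  finally show ?thesis .
qed

lemma V_eq:
  assumes nu: "0 \<le> \<nu>" and t: "0 \<le> t"
  shows "b * V \<nu> t + conv k (V \<nu>) t = \<nu> * conv (\<lambda>_. 1) (S \<nu>) t"
proof -
  have Vc: "V \<nu> x = \<nu> * conv a (S \<nu>) x" if "x \<in> {0..t}" for x
    using S_eq[of \<nu> x] V_eq_S[of \<nu> x] that nu by auto
  have "conv k (V \<nu>) t = conv k (\<lambda>x. \<nu> * conv a (S \<nu>) x) t"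
    by (rule conv_cong_right) (rule Vc)
  also have "\<dots> = \<nu> * conv (conv k a) (S \<nu>) t"
    by (simp add: conv_cmult_right conv_assoc k a S_continuous' nu)
  finally have "b * V \<nu> t + conv k (V \<nu>) t = \<nu> * (conv (\<lambda>x. b * a x) (S \<nu>) t + conv (conv k a) (S \<nu>) t)"
    using Vc[of t] t by (simp add: conv_cmult_left algebra_simps)
  also have "conv (\<lambda>x. b * a x) (S \<nu>) t + conv (conv k a) (S \<nu>) t
      = conv (\<lambda>x. b * a x + conv k a x) (S \<nu>) t"
    by (rule conv_add_left[symmetric]) (intro L1_loc_cmult L1_loc_conv a k S_continuous' nu)+
  also have "\<dots> = conv (\<lambda>_. 1) (S \<nu>) t"
    by (rule conv_cong_AE_left)
       (intro L1_loc_add L1_loc_cmult L1_loc_conv L1_loc_const a k S_continuous' nu pair)+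
  finally show ?thesis .
qed

text \<open>The positive part of t makes the equation hold at all real times, so that its version at
  t - d can be subtracted.\<close>

lemma V_eq':
  assumes "0 \<le> \<nu>"
  shows "b * V \<nu> t + conv k (V \<nu>) t = \<nu> * (max t 0 - conv (\<lambda>_. 1) (V \<nu>) t)"
  using V_eq[OF assms, of t] conv1_S[OF assms, of t]
  by (cases "t < 0") (auto simp: conv_neg V_def)

text \<open>The source \<open>max t 0\<close> grows with slope at most 1, so the maximum principle
  gives the bound c = 1.\<close>

lemma V_le_1:
  assumes "0 < \<nu>"
  shows "V \<nu> t \<le> 1"
proof (cases "t \<le> 0")
  case False
  show ?thesis
    by (rule maximum_principle[OF k b assms, where G="\<lambda>t. max t 0"])
       (use assms V_eq' False in \<open>auto intro!: V_continuous continuous_intros\<close>)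
qed (simp add: V_def)

text \<open>The shifted \<open>V\<close> minus \<open>V\<close> solves the same equation with the
  nonincreasing source max (t - d) 0 - max t 0, so the maximum principle applies with c = 0.\<close>

lemma V_mono:
  assumes nu: "0 < \<nu>" and "t' \<le> t"
  shows "V \<nu> t' \<le> V \<nu> t"
proof -
  define d where "d = t - t'"
  have d: "d \<ge> 0" using assms by (simp add: d_def)
  define u where "u = (\<lambda>x. V \<nu> (x - d) - V \<nu> x)"
  have Vs: "continuous_on X (\<lambda>x. V \<nu> (x - d))" for X
    by (rule continuous_on_compose2[OF V_continuous[of \<nu> UNIV]]) (use nu in \<open>auto intro!: continuous_intros\<close>)
  have V: "continuous_on X (V \<nu>)" for X using nu by (intro V_continuous) auto
  have cu: "conv f u x = conv f (V \<nu>) (x - d) - conv f (V \<nu>) x" if "L1_loc f" for f x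
    unfolding u_def using conv_shift[of "V \<nu>" d f x] d
    by (simp add: conv_diff_right[OF that Vs V]) (simp add: V_def)
  have "u t \<le> 0" if "t > 0" for t
  proof (rule maximum_principle[OF k b nu, where u=u and c=0 and G="\<lambda>t. max (t - d) 0 - max t 0"])
    show "continuous_on {0..} u" unfolding u_def by (intro continuous_intros Vs V)
    show "b * u t + conv k u t = \<nu> * (max (t - d) 0 - max t 0 - conv (\<lambda>_. 1) u t)" for t
      using V_eq'[of \<nu> t] V_eq'[of \<nu> "t - d"] nu
      unfolding cu[OF k(1)] cu[OF L1_loc_const] by (simp add: u_def algebra_simps)
  qed (use that d in \<open>auto intro!: continuous_intros\<close>)
  from this[of t] show ?thesis using d
    by (cases "t > 0") (auto simp: u_def d_def V_def)
qed

lemma S_nonneg: "0 \<le> \<nu> \<Longrightarrow> 0 \<le> t \<Longrightarrow> 0 \<le> S \<nu> t"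
  using V_le_1[of \<nu> t] V_eq_S[of \<nu> t] S_zero[of t] by (cases "\<nu> = 0") auto

lemma S_antimono: "0 \<le> \<nu> \<Longrightarrow> 0 \<le> t' \<Longrightarrow> t' \<le> t \<Longrightarrow> S \<nu> t \<le> S \<nu> t'"
  using V_mono[of \<nu> t' t] V_eq_S[of \<nu> t] V_eq_S[of \<nu> t'] S_zero[of t] S_zero[of t']
  by (cases "\<nu> = 0") auto

lemma S_le_1: "0 \<le> \<nu> \<Longrightarrow> 0 \<le> t \<Longrightarrow> S \<nu> t \<le> 1"
  using S_antimono[of \<nu> 0 t] S_at_0[of \<nu>] by auto

lemma V_nonneg: "0 < \<nu> \<Longrightarrow> 0 \<le> V \<nu> t"
  using S_le_1[of \<nu> t] by (auto simp: V_def)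

text \<open>Monotonicity of \<open>V\<close> against the nonnegative kernel g - c. The later uses
  take \<open>k\<close>, \<open>S \<mu>\<close> and - \<open>S \<mu>\<close> for g.\<close>

lemma conv_V_incr:
  assumes nu: "0 < \<nu>" and g: "L1_loc g" "\<And>x. 0 < x \<Longrightarrow> x \<le> t \<Longrightarrow> c \<le> g x"
    and t: "0 \<le> t'" "t' \<le> t"
  shows "c * (conv (\<lambda>_. 1) (V \<nu>) t - conv (\<lambda>_. 1) (V \<nu>) t') \<le> conv g (V \<nu>) t - conv g (V \<nu>) t'"
proof -
  have le: "conv (\<lambda>x. g x - c * 1) (V \<nu>) t' \<le> conv (\<lambda>x. g x - c * 1) (V \<nu>) t"
    by (rule conv_mono_incr)
       (use assms V_mono in \<open>auto intro!: L1_loc_diff L1_loc_const V_continuous mono_onI simp: V_def[of _ 0]\<close>)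
  have "conv (\<lambda>x. g x - c * 1) (V \<nu>) r = conv g (V \<nu>) r - c * conv (\<lambda>_. 1) (V \<nu>) r" for r
    unfolding conv_cmult_left[symmetric] using nu by (intro conv_diff_left g(1) L1_loc_const V_continuous) simp
  then show ?thesis using le by (simp add: right_diff_distrib)
qed

text \<open>Formally b V' + (k*V)' = \<nu> S, where b V' >= 0 and (k*V)' (t) >= k t V t because
  \<open>k\<close> is at least k t on (0, t]. In the proof, this is done with the primitive of
  \<open>q\<close>.\<close>

lemma S_lower:
  assumes nu: "0 < \<nu>" and t: "0 < t"
  shows "k t * (1 - S \<nu> t) \<le> \<nu> * S \<nu> t"
proof -
  have nu': "0 \<le> \<nu>" using nu by simp
  define q where "q = (\<lambda>x. \<nu> * S \<nu> x - k t * V \<nu> x)"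
  have "0 \<le> q t"
  proof (rule conv1_last_max_nonneg[OF _ t])
    show "continuous_on {0..t} q"
      unfolding q_def by (intro continuous_intros S_continuous' V_continuous nu')
    fix t' assume t': "0 \<le> t'" "t' \<le> t"
    have q: "conv (\<lambda>_. 1) q r = \<nu> * conv (\<lambda>_. 1) (S \<nu>) r - k t * conv (\<lambda>_. 1) (V \<nu>) r" for r
      unfolding q_def using conv_diff_right[OF L1_loc_const[of 1], of r "\<lambda>x. \<nu> * S \<nu> x" "\<lambda>x. k t * V \<nu> x"]
      by (simp add: conv_cmult_right continuous_on_mult_left S_continuous' V_continuous nu')
    have "k t * (conv (\<lambda>_. 1) (V \<nu>) t - conv (\<lambda>_. 1) (V \<nu>) t') \<le> conv k (V \<nu>) t - conv k (V \<nu>) t'"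
      using t t' monotone_onD[OF k(3)] by (intro conv_V_incr nu k) auto
    moreover have "b * V \<nu> t' \<le> b * V \<nu> t" using V_mono[OF nu t'(2)] b by (rule mult_left_mono)
    ultimately show "conv (\<lambda>_. 1) q t' \<le> conv (\<lambda>_. 1) q t"
      using V_eq[OF nu', of t] V_eq[OF nu', of t'] t t' unfolding q by (simp add: right_diff_distrib)
  qed
  then show ?thesis using V_eq_S[OF nu', of t] t by (simp add: q_def)
qed

text \<open>The difference \<open>w\<close> of two solutions satisfies \<open>1 * w = S \<mu> * f\<close> with the
  nondecreasing function \<open>f = (1 - \<mu> / \<nu>) (1 - S \<nu>)\<close>.\<close>

lemma S_diff:
  assumes mu: "0 < \<mu>" "\<mu> \<le> \<nu>" and t: "0 < t"
  shows "(1 - \<mu> / \<nu>) * (1 - S \<nu> t) * S \<mu> t \<le> S \<mu> t - S \<nu> t" (is ?lower)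
    and "S \<mu> t - S \<nu> t \<le> (1 - \<mu> / \<nu>) * (1 - S \<nu> t)" (is ?upper)
proof -
  have nu: "0 < \<nu>" "0 \<le> \<nu>" "0 \<le> \<mu>" using mu by auto
  define C where "C = 1 - \<mu> / \<nu>"
  have C: "0 \<le> C" using mu by (simp add: C_def field_simps)
  define w where "w = (\<lambda>x. S \<mu> x - S \<nu> x)"
  have wc: "continuous_on {0..} w" unfolding w_def by (intro continuous_intros S_continuous nu)
  have wc': "continuous_on {0..r} w" for r unfolding w_def by (intro continuous_intros S_continuous' nu)
  have cw: "continuous_on {0..r} (conv a w)" for r
    using continuous_on_conv[OF a wc] by (auto elim: continuous_on_subset)
  have eq: "w x + \<mu> * conv a w x = C * V \<nu> x" if "0 \<le> x" for x
  proof -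
    have "conv a w x = conv a (S \<mu>) x - conv a (S \<nu>) x"
      unfolding w_def by (intro conv_diff_right a S_continuous' nu)
    then have "\<nu> * (w x + \<mu> * conv a w x) = (\<nu> - \<mu>) * (\<nu> * conv a (S \<nu>) x)"
      using S_eq[OF nu(2) that] S_eq[OF nu(3) that] unfolding w_def by algebra
    also have "\<nu> * conv a (S \<nu>) x = V \<nu> x"
      using S_eq[OF nu(2) that] V_eq_S[OF nu(2) that] by simp
    finally show ?thesis using nu(1) by (simp add: C_def field_simps)
  qed
  have LS: "L1_loc (S \<mu>)" by (intro L1_loc_continuous S_continuous nu)
  \<comment> \<open>Convolving \<open>eq\<close> with \<open>S \<mu>\<close> inverts its left-hand
    side up to one integration, since S \<mu> + \<mu> a*(S \<mu>) = 1.\<close>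
  have key: "conv (\<lambda>_. 1) w r = C * conv (S \<mu>) (V \<nu>) r" if r: "0 \<le> r" for r
  proof -
    have "conv (S \<mu>) (\<lambda>x. w x + \<mu> * conv a w x) r = conv (S \<mu>) (\<lambda>x. C * V \<nu> x) r"
      by (rule conv_cong_right) (auto simp: eq)
    then have "C * conv (S \<mu>) (V \<nu>) r = conv (S \<mu>) w r + \<mu> * conv (S \<mu>) (conv a w) r"
      using conv_add_right[OF LS wc', of r "\<lambda>x. \<mu> * conv a w x"]
      by (simp add: conv_cmult_right continuous_on_mult_left cw)
    also have "conv (S \<mu>) (conv a w) r = conv (conv a (S \<mu>)) w r"
    proof -
      have "conv (S \<mu>) a = conv a (S \<mu>)" by (rule ext, rule conv_commute)
      then show ?thesis using conv_assoc[OF LS a wc', of r] by simp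
    qed
    also have "\<mu> * conv (conv a (S \<mu>)) w r = conv (\<lambda>x. \<mu> * conv a (S \<mu>) x) w r"
      by (simp add: conv_cmult_left)
    also have "conv (S \<mu>) w r + conv (\<lambda>x. \<mu> * conv a (S \<mu>) x) w r
        = conv (\<lambda>x. S \<mu> x + \<mu> * conv a (S \<mu>) x) w r"
      by (rule conv_add_left[symmetric]) (intro LS L1_loc_cmult L1_loc_conv a wc')+
    also have "\<dots> = conv (\<lambda>_. 1) w r"
      using S_eq[OF nu(3)]
      by (intro conv_cong_AE_left L1_loc_add LS L1_loc_cmult L1_loc_conv a wc' L1_loc_const) auto
    finally show ?thesis by simp
  qed
  have V: "continuous_on X (V \<nu>)" for X using nu by (intro V_continuous)
  have lin: "conv (\<lambda>_. 1) (\<lambda>x. p * w x + q * (C * V \<nu> x)) r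
      = C * (p * conv (S \<mu>) (V \<nu>) r + q * conv (\<lambda>_. 1) (V \<nu>) r)" if "0 \<le> r" for p q r
    using conv_add_right[OF L1_loc_const[of 1], of r "\<lambda>x. p * w x" "\<lambda>x. q * (C * V \<nu> x)"] key[OF that]
    by (simp add: conv_cmult_right continuous_on_mult_left wc' V algebra_simps)
  have "0 \<le> 1 * w t + (- S \<mu> t) * (C * V \<nu> t)"
  proof (rule conv1_last_max_nonneg[where q="\<lambda>x. 1 * w x + (- S \<mu> t) * (C * V \<nu> x)", OF _ t])
    show "continuous_on {0..t} (\<lambda>x. 1 * w x + (- S \<mu> t) * (C * V \<nu> x))"
      by (intro continuous_intros wc' V)
    fix t' assume t': "0 \<le> t'" "t' \<le> t"
    \<comment> \<open>Lower bound: \<open>S \<mu>\<close> is nonincreasing, hence at least S \<mu> t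
      on (0, t].\<close>
    have "S \<mu> t * (conv (\<lambda>_. 1) (V \<nu>) t - conv (\<lambda>_. 1) (V \<nu>) t')
        \<le> conv (S \<mu>) (V \<nu>) t - conv (S \<mu>) (V \<nu>) t'"
      using S_antimono[OF nu(3)] t' by (intro conv_V_incr nu LS) auto
    from mult_left_mono[OF this C]
    show "conv (\<lambda>_. 1) (\<lambda>x. 1 * w x + (- S \<mu> t) * (C * V \<nu> x)) t'
        \<le> conv (\<lambda>_. 1) (\<lambda>x. 1 * w x + (- S \<mu> t) * (C * V \<nu> x)) t"
      unfolding lin[OF t'(1)] lin[OF less_imp_le[OF t]] by (simp add: algebra_simps)
  qed
  then show ?lower using V_eq_S[OF nu(2), of t] t by (simp add: C_def w_def algebra_simps)
  have "0 \<le> (- 1) * w t + 1 * (C * V \<nu> t)"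
  proof (rule conv1_last_max_nonneg[where q="\<lambda>x. (- 1) * w x + 1 * (C * V \<nu> x)", OF _ t])
    show "continuous_on {0..t} (\<lambda>x. (- 1) * w x + 1 * (C * V \<nu> x))"
      by (intro continuous_intros wc' V)
    fix t' assume t': "0 \<le> t'" "t' \<le> t"
    \<comment> \<open>Upper bound: the same increment estimate for the kernel - S \<mu>, which is at
      least -1.\<close>
    have "(- 1) * (conv (\<lambda>_. 1) (V \<nu>) t - conv (\<lambda>_. 1) (V \<nu>) t')
        \<le> conv (\<lambda>x. (- 1) * S \<mu> x) (V \<nu>) t - conv (\<lambda>x. (- 1) * S \<mu> x) (V \<nu>) t'"
      using S_le_1[OF nu(3)] t' by (intro conv_V_incr nu LS L1_loc_cmult) auto
    from mult_left_mono[OF this C]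
    show "conv (\<lambda>_. 1) (\<lambda>x. (- 1) * w x + 1 * (C * V \<nu> x)) t'
        \<le> conv (\<lambda>_. 1) (\<lambda>x. (- 1) * w x + 1 * (C * V \<nu> x)) t"
      unfolding lin[OF t'(1)] lin[OF less_imp_le[OF t]] conv_cmult_left by (simp add: algebra_simps)
  qed
  then show ?upper using V_eq_S[OF nu(2), of t] t by (simp add: C_def w_def algebra_simps)
qed

text \<open>The lower bound in \<open>S_diff\<close> is nonnegative. It serves for measurability in
  the parameter and for reducing the shell to its extreme parameters; \<mu> = 0 is separate because
  of the quotient estimate.\<close>

lemma S_antimono_right:
  assumes "0 \<le> \<mu>" "\<mu> \<le> \<nu>" and t: "0 < t"
  shows "S \<nu> t \<le> S \<mu> t"
proof (cases "\<mu> = 0")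
  case True
  then show ?thesis using S_zero[of t] S_le_1[of \<nu> t] assms by simp
next
  case False
  then have "0 \<le> (1 - \<mu> / \<nu>) * (1 - S \<nu> t) * S \<mu> t"
    using S_le_1[of \<nu> t] S_nonneg[of \<mu> t] assms by (intro mult_nonneg_nonneg) (auto simp: field_simps)
  then show ?thesis using S_diff(1)[of \<mu> \<nu> t] False assms by linarith
qed

text \<open>As \<open>\<epsilon>\<close> tends to 0, \<open>S \<epsilon>\<close> tends to 1 and \<open>(1 - S \<epsilon>) / \<epsilon> = a * S \<epsilon>\<close> to \<open>A\<close>.\<close>

lemma conv_a_S_tendsto:
  assumes t: "0 < t"
  shows "((\<lambda>e. conv a (S e) t) \<longlongrightarrow> A t) (at_right 0)"
    and "((\<lambda>e. S e t) \<longlongrightarrow> 1) (at_right 0)"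
proof -
  define I where "I = (LINT x:{0..t}|lborel. \<bar>a x\<bar>)"
  \<comment> \<open>Since 0 <= S <= 1, the integral I of |a| bounds a*(S e). The estimate is uniform
    on [0, t], as the convolution of 1 - S e with \<open>a\<close> requires.\<close>
  have near: "\<bar>1 - S e x\<bar> \<le> e * I" if "0 < e" "x \<in> {0..t}" for e x
  proof -
    have "\<bar>conv a (S e) x\<bar> \<le> (LINT x:{0..x}|lborel. \<bar>a x\<bar>) * 1"
      using that S_nonneg[of e] S_le_1[of e] by (intro conv_abs_le a S_continuous') auto
    also have "\<dots> \<le> I" using set_integral_abs_mono[OF a, of x t] that by (simp add: I_def)
    finally have "e * \<bar>conv a (S e) x\<bar> \<le> e * I" using that by (intro mult_left_mono) auto
    moreover have "1 - S e x = e * conv a (S e) x" using S_eq[of e x] that by simp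
    ultimately show ?thesis using that by (simp add: abs_mult)
  qed
  have lim: "((\<lambda>e. e * c) \<longlongrightarrow> 0) (at_right 0)" for c :: real
    using tendsto_mult_right[OF tendsto_ident_at, of c 0 "{0<..}"] by simp
  have "((\<lambda>e. S e t - 1) \<longlongrightarrow> 0) (at_right 0)"
    by (rule Lim_null_comparison[OF _ lim[of I]])
       (use t near[of _ t] in \<open>auto simp: eventually_at_filter abs_minus_commute\<close>)
  then show "((\<lambda>e. S e t) \<longlongrightarrow> 1) (at_right 0)" by (simp add: LIM_zero_iff)
  have "\<bar>conv a (S e) t - A t\<bar> \<le> e * (I * I)" if "0 < e" for e
  proof -
    have "conv a (\<lambda>x. 1 - S e x) t = A t - conv a (S e) t"
      unfolding conv_commute[of "\<lambda>_. 1" a]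
      using that by (intro conv_diff_right) (auto intro: a S_continuous')
    moreover have "\<bar>conv a (\<lambda>x. 1 - S e x) t\<bar> \<le> I * (e * I)"
    proof (subst I_def, rule conv_abs_le[OF a])
      show "continuous_on {0..t} (\<lambda>x. 1 - S e x)"
        using that by (intro continuous_intros S_continuous') simp
    qed (rule near[OF that])
    ultimately show ?thesis by (simp add: abs_minus_commute mult_ac)
  qed
  then have "((\<lambda>e. conv a (S e) t - A t) \<longlongrightarrow> 0) (at_right 0)"
    by (intro Lim_null_comparison[OF _ lim[of "I * I"]]) (auto simp: eventually_at_filter)
  then show "((\<lambda>e. conv a (S e) t) \<longlongrightarrow> A t) (at_right 0)" by (simp add: LIM_zero_iff)
qed

text \<open>As \<open>a\<close> may change sign, this is obtained from A t as the limit of the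
  nonnegative quotients (1 - S e t) / e.\<close>

lemma A_nonneg:
  assumes t: "0 < t" shows "0 \<le> A t"
proof (rule tendsto_lowerbound[OF conv_a_S_tendsto(1)[OF t]])
  have "0 \<le> conv a (S e) t" if "0 < e" for e
  proof -
    have "0 \<le> e * conv a (S e) t" using S_eq[of e t] S_le_1[of e t] that t by simp
    then show ?thesis using that by (simp add: zero_le_mult_iff)
  qed
  then show "\<forall>\<^sub>F e in at_right 0. 0 \<le> conv a (S e) t"
    by (auto simp: eventually_at_filter)
qed simp

text \<open>The lower bound of \<open>S_diff\<close> between e and \<nu> rearranges to \<nu> (S
  \<nu>) (1 - S e) <= e (1 - S \<nu>) (S e) at time t; divide by e and let e tend to 0.\<close>

lemma S_upper:
  assumes nu: "0 < \<nu>" and t: "0 < t"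
  shows "\<nu> * S \<nu> t * A t \<le> 1 - S \<nu> t"
proof -
  have "\<nu> * S \<nu> t * conv a (S e) t \<le> (1 - S \<nu> t) * S e t" if e: "0 < e" "e \<le> \<nu>" for e
  proof -
    have "e * conv a (S e) t = 1 - S e t"
      using S_eq[of e t] e t by simp
    then have "e * (\<nu> * S \<nu> t * conv a (S e) t) = \<nu> * S \<nu> t * (1 - S e t)"
      by (metis mult.left_commute)
    also have "\<dots> \<le> e * ((1 - S \<nu> t) * S e t)"
    proof -
      have "\<nu> * ((1 - e / \<nu>) * (1 - S \<nu> t) * S e t) \<le> \<nu> * (S e t - S \<nu> t)"
        using S_diff(1)[OF e t] nu by (intro mult_left_mono) auto
      moreover have "\<nu> * ((1 - e / \<nu>) * (1 - S \<nu> t) * S e t) = (\<nu> - e) * (1 - S \<nu> t) * S e t"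
        using nu by (simp add: field_simps)
      ultimately show ?thesis by (simp add: algebra_simps)
    qed
    finally show ?thesis using e by simp
  qed
  then have ev: "\<forall>\<^sub>F e in at_right 0. \<nu> * S \<nu> t * conv a (S e) t \<le> (1 - S \<nu> t) * S e t"
    using nu by (intro eventually_at_rightI[of 0 \<nu>]) auto
  have "\<nu> * S \<nu> t * A t \<le> (1 - S \<nu> t) * 1"
    by (rule tendsto_le[OF trivial_limit_at_right_real _ _ ev])
       (intro tendsto_intros conv_a_S_tendsto[OF t])+
  then show ?thesis by simp
qed

text \<open>Continuity at 0 gives S \<mu> > 0 for small t. If S \<nu> t were 1, monotonicity would
  make \<open>V \<nu>\<close> vanish on [0, t], and its equation at t would read 0 = \<nu>
  t.\<close>

lemma S_nontrivial:
  assumes "0 \<le> \<mu>" "0 < \<nu>"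
  obtains t where "0 < t" "0 < S \<mu> t" "S \<nu> t < 1"
proof -
  have "(S \<mu> \<longlongrightarrow> 1) (at 0 within {0..})"
    using S_continuous[OF assms(1)] S_at_0[OF assms(1)]
    unfolding continuous_on_def by (metis atLeast_iff order_refl)
  then have "\<forall>\<^sub>F x in at 0 within {0..}. 0 < S \<mu> x" by (rule order_tendstoD) simp
  then obtain r where r: "r > 0" "\<And>x. x \<ge> 0 \<Longrightarrow> x \<noteq> 0 \<Longrightarrow> dist x 0 < r \<Longrightarrow> 0 < S \<mu> x"
    by (auto simp: eventually_at)
  define t where "t = r / 2"
  have t: "0 < t" "0 < S \<mu> t" using r by (auto simp: t_def)
  have "S \<nu> t \<noteq> 1"
  proof
    assume 1: "S \<nu> t = 1"
    have V0: "V \<nu> x = 0" if "x \<in> {0..t}" for x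
      using V_mono[of \<nu> x t] V_nonneg[of \<nu> x] V_eq_S[of \<nu> t] that assms 1 by auto
    \<comment> \<open>The zero function is spelled \<open>0 * 0\<close> so that
      \<open>conv_cmult_right\<close> evaluates both convolutions to 0.\<close>
    then have "conv k (V \<nu>) t = conv k (\<lambda>_. 0 * 0) t" "conv (\<lambda>_. 1) (V \<nu>) t = conv (\<lambda>_. 1) (\<lambda>_. 0 * 0) t"
      by (auto intro!: conv_cong_right)
    then have "\<nu> * t = 0"
      unfolding conv_cmult_right using V_eq'[of \<nu> t] V0[of t] t assms by simp
    then show False using t assms by simp
  qed
  then show ?thesis using that[of t] t S_le_1[of \<nu> t] assms by simp
qed

end


section \<open>Sobolev norms of radial bounds\<close>

text \<open>A discrete substitute for polar coordinates: f is at most the sum of c k times the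
  indicators of the balls, and their volumes scale as r k ^ DIM.\<close>

lemma integrable_if_dominated_on_cballs:
  fixes f :: "'a::euclidean_space \<Rightarrow> real"
  assumes [measurable]: "f \<in> borel_measurable borel" and f0: "\<And>x. 0 \<le> f x"
    and c: "\<And>k. 0 \<le> c k" "\<And>k. 0 \<le> r k" "summable (\<lambda>k::nat. c k * r k ^ DIM('a))"
    and cover: "AE x in lborel. f x \<noteq> 0 \<longrightarrow> (\<exists>k. norm x \<le> r k \<and> f x \<le> c k)"
  shows "integrable lborel f"
proof (rule integrableI_nonneg)
  let ?v = "unit_ball_vol (real DIM('a))"
  have "(\<integral>\<^sup>+x. f x \<partial>lborel) \<le> (\<integral>\<^sup>+x. (\<Sum>k. ennreal (c k) * indicator (cball 0 (r k)) x) \<partial>(lborel :: 'a measure))"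
  proof (rule nn_integral_mono_AE)
    show "AE x in lborel. ennreal (f x) \<le> (\<Sum>k. ennreal (c k) * indicator (cball 0 (r k)) x)"
      using cover
    proof eventually_elim
      case (elim x)
      show ?case
      proof (cases "f x = 0")
        case False
        then obtain k where k: "norm x \<le> r k" "f x \<le> c k" using elim by blast
        then have "ennreal (f x) \<le> (\<Sum>i\<in>{k}. ennreal (c i) * indicator (cball 0 (r i)) x)"
          by (simp add: ennreal_leI)
        also have "\<dots> \<le> (\<Sum>k. ennreal (c k) * indicator (cball 0 (r k)) x)"
          by (rule sum_le_suminf) auto
        finally show ?thesis .
      qed simp
    qed
  qed
  also have "\<dots> = (\<Sum>k. \<integral>\<^sup>+x. ennreal (c k) * indicator (cball 0 (r k)) x \<partial>(lborel :: 'a measure))"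
  proof (rule nn_integral_suminf)
    fix k
    have [measurable]: "cball (0 :: 'a) (r k) \<in> sets lborel" by simp
    show "(\<lambda>x. ennreal (c k) * indicator (cball (0 :: 'a) (r k)) x) \<in> borel_measurable lborel"
      by measurable
  qed
  also have "\<dots> = (\<Sum>k. ennreal (?v * (c k * r k ^ DIM('a))))"
  proof (rule suminf_cong)
    fix k
    have "(\<integral>\<^sup>+x. ennreal (c k) * indicator (cball 0 (r k)) x \<partial>(lborel::'a measure))
        = ennreal (c k) * emeasure lborel (cball (0::'a) (r k))"
      by (rule nn_integral_cmult_indicator) simp
    also have "\<dots> = ennreal (?v * (c k * r k ^ DIM('a)))"
      using c(1,2)[of k] by (simp add: emeasure_cball ennreal_mult[symmetric] mult_ac)
    finally show "(\<integral>\<^sup>+x. ennreal (c k) * indicator (cball 0 (r k)) x \<partial>(lborel::'a measure))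
        = ennreal (?v * (c k * r k ^ DIM('a)))" .
  qed
  also have "\<dots> = ennreal (\<Sum>k. ?v * (c k * r k ^ DIM('a)))"
    using c by (intro suminf_ennreal2 summable_mult) auto
  also have "\<dots> < \<infinity>" by simp
  finally show "(\<integral>\<^sup>+x. f x \<partial>lborel) < \<infinity>" .
qed (use f0 in auto)

text \<open>Dyadic shells: with |x| = 2^(-L) or 2^L and k the integer part of L, the k-th ball has
  radius 2^(-k) or 2^(k+1). The resulting series are geometric with ratios 2^(p-n) and 2^(n-q), n
  being the dimension.\<close>

lemma integrable_radial:
  fixes f :: "'a::euclidean_space \<Rightarrow> real"
  assumes f[measurable]: "f \<in> borel_measurable borel" and f0: "\<And>x. 0 \<le> f x" and C: "0 \<le> C"
    and p: "0 \<le> p" "p < real DIM('a)" and q: "real DIM('a) < q"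
    and near: "\<And>x. x \<noteq> 0 \<Longrightarrow> norm x < 1 \<Longrightarrow> f x \<le> C * norm x powr (- p)"
    and far: "\<And>x. 1 \<le> norm x \<Longrightarrow> f x \<le> C * norm x powr (- q)"
  shows "integrable lborel f"
proof -
  let ?n = "DIM('a)"
  have nat_floor: "real (nat \<lfloor>L\<rfloor>) \<le> L" "L \<le> real (nat \<lfloor>L\<rfloor>) + 1" if "0 \<le> L" for L :: real
    using that by linarith+
  have geo: "summable (\<lambda>k. D * (2 powr e) ^ k)" if "e < 0" for D e :: real
    using that by (intro summable_mult summable_geometric) (simp add: powr_less_one)
  have powr_nat: "(2 powr x :: real) ^ k = 2 powr (x * real k)" for x and k :: nat
    by (simp add: powr_powr flip: powr_realpow)
  have "integrable lborel (\<lambda>x. indicator (ball 0 1) x * f x)"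
  proof (rule integrable_if_dominated_on_cballs)
    show "(\<lambda>x. indicator (ball 0 1) x * f x) \<in> borel_measurable borel"
      by (intro borel_measurable_times borel_measurable_indicator f) simp
    show "summable (\<lambda>k. (C * 2 powr (p * (real k + 1))) * (2 powr (- real k)) ^ ?n)"
    proof -
      have "(C * 2 powr p) * (2 powr (p - ?n)) ^ k
          = (C * 2 powr (p * (real k + 1))) * (2 powr (- real k)) ^ ?n" for k
        unfolding powr_nat mult.assoc powr_add[symmetric] by (simp add: algebra_simps)
      then show ?thesis using geo[of "p - ?n" "C * 2 powr p"] p by (simp only:)
    qed
    show "AE x in lborel. indicator (ball 0 1) x * f x \<noteq> 0 \<longrightarrow> (\<exists>k. norm x \<le> 2 powr - real k \<and>
        indicator (ball 0 1) x * f x \<le> C * 2 powr (p * (real k + 1)))"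
      using AE_lborel_singleton[of "0::'a"]
    proof eventually_elim
      case (elim x)
      show ?case
      proof (cases "norm x < 1")
        case True
        define L where "L = - log 2 (norm x)"
        have L: "0 \<le> L" "norm x = 2 powr (- L)"
          using True elim by (auto simp: L_def)
        define k where "k = nat \<lfloor>L\<rfloor>"
        note k = nat_floor[OF L(1), folded k_def]
        have "f x \<le> C * 2 powr (L * p)" using near[OF elim True] L(2) by (simp add: powr_powr)
        also have "\<dots> \<le> C * 2 powr (p * (real k + 1))"
          using k p mult_right_mono[of L "real k + 1" p] by (intro mult_left_mono C) (simp add: mult.commute)
        finally show ?thesis using True L k by (intro impI exI[of _ k]) simp
      qed simp
    qed
  qed (use C f0 in auto)
  moreover have "integrable lborel (\<lambda>x. indicator (- ball 0 1) x * f x)"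
  proof (rule integrable_if_dominated_on_cballs)
    show "(\<lambda>x. indicator (- ball 0 1) x * f x) \<in> borel_measurable borel"
      by (intro borel_measurable_times borel_measurable_indicator f) simp
    show "summable (\<lambda>k. (C * 2 powr (- q * real k)) * (2 powr (real k + 1)) ^ ?n)"
    proof -
      have "(C * 2 powr ?n) * (2 powr (?n - q)) ^ k
          = (C * 2 powr (- q * real k)) * (2 powr (real k + 1)) ^ ?n" for k
        unfolding powr_nat mult.assoc powr_add[symmetric] by (simp add: algebra_simps)
      then show ?thesis using geo[of "?n - q" "C * 2 powr ?n"] q by (simp only:)
    qed
    show "AE x in lborel. indicator (- ball 0 1) x * f x \<noteq> 0 \<longrightarrow> (\<exists>k. norm x \<le> 2 powr (real k + 1) \<and>
        indicator (- ball 0 1) x * f x \<le> C * 2 powr (- q * real k))"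
    proof (rule AE_I2)
      fix x :: 'a
      show "indicator (- ball 0 1) x * f x \<noteq> 0 \<longrightarrow> (\<exists>k. norm x \<le> 2 powr (real k + 1) \<and>
        indicator (- ball 0 1) x * f x \<le> C * 2 powr (- q * real k))"
      proof (cases "norm x < 1")
        case False
        define L where "L = log 2 (norm x)"
        have "0 < norm x" using False by linarith
        then have L: "0 \<le> L" "norm x = 2 powr L"
          using False by (auto simp: L_def not_less)
        define k where "k = nat \<lfloor>L\<rfloor>"
        note k = nat_floor[OF L(1), folded k_def]
        have "f x \<le> C * 2 powr (- q * L)"
          using far[of x] False L(2) by (simp add: powr_powr mult.commute)
        also have "\<dots> \<le> C * 2 powr (- q * real k)"
          using k q mult_left_mono[of "real k" L q] by (intro mult_left_mono C) simp
        finally show ?thesis using False L k by (intro impI exI[of _ k]) simp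
      qed simp
    qed
  qed (use C f0 in auto)
  ultimately have "integrable lborel (\<lambda>x. indicator (ball 0 1) x * f x + indicator (- ball 0 1) x * f x)"
    by (rule Bochner_Integration.integrable_add)
  moreover have "indicator (ball 0 1) x * f x + indicator (- ball 0 1) x * f x = f x" for x
    by (simp add: indicator_def)
  ultimately show ?thesis by simp
qed

lemma integrable_sobolev_weight_ln:
  fixes s \<beta> :: real
  assumes \<beta>: "0 \<le> \<beta>" "\<beta> < s - real DIM('a) / 2"
  shows "integrable lborel (\<lambda>\<xi>::'a::euclidean_space.
    (1 + (norm \<xi>)\<^sup>2) powr (- s) * (norm \<xi> powr \<beta> * ln (norm \<xi>))\<^sup>2)"
proof -
  \<comment> \<open>The margin s - \<beta> - n/2 is 2 e. Half of it pays for the squared logarithm,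
    of order |xi|^(2 e), and the remaining decay exponent n + 2 e still exceeds the dimension
    n.\<close>
  define e where "e = (s - \<beta> - real DIM('a) / 2) / 2"
  have e: "e > 0" using \<beta> by (simp add: e_def)
  have s: "s > 0" using \<beta> DIM_positive[where 'a='a] by (smt (verit) of_nat_0_le_iff divide_nonneg_nonneg)
  have dim1: "1 \<le> real DIM('a)" using DIM_positive[where 'a='a] by linarith
  have ln_sq: "(ln x)\<^sup>2 \<le> 1 / d\<^sup>2 * x powr (2 * d)" if "1 \<le> x" "0 < d" for x d :: real
  proof -
    have "(ln x)\<^sup>2 \<le> (x powr d / d)\<^sup>2"
      using ln_powr_bound[OF that] that by (intro power_mono) auto
    also have "\<dots> = 1 / d\<^sup>2 * x powr (2 * d)"
      by (simp add: power_divide power2_eq_square flip: powr_add)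
    finally show ?thesis .
  qed
  show ?thesis
  \<comment> \<open>Near 0, \<open>ln_sq\<close> at 1/|xi| with d = 1/4 gives 16 |xi|^(-1/2), and
    1/2 is below every dimension; far out, d = e gives 1 / e^2. The constant C is the sum of
    both.\<close>
  proof (rule integrable_radial[where p="1/2" and q="2 * (s - \<beta> - e)" and C="16 + 1 / e\<^sup>2"])
    show "1 / 2 < real DIM('a)" using dim1 by linarith
    show "real DIM('a) < 2 * (s - \<beta> - e)" using \<beta> by (simp add: e_def field_simps)
    fix \<xi> :: 'a
    let ?r = "norm \<xi>"
    let ?f = "(1 + ?r\<^sup>2) powr (- s) * (?r powr \<beta> * ln ?r)\<^sup>2"
    show "?f \<le> (16 + 1 / e\<^sup>2) * ?r powr - (1/2)" if "\<xi> \<noteq> 0" "?r < 1"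
    proof -
      have r: "0 < ?r" using that by simp
      have "?f \<le> 1 * (1 * ln ?r)\<^sup>2"
      proof (rule mult_mono)
        show "(1 + ?r\<^sup>2) powr (- s) \<le> 1" using s powr_mono2'[of "-s" 1 "1 + ?r\<^sup>2"] by simp
        have "?r powr \<beta> \<le> 1" using \<beta> that powr_mono2[of \<beta> ?r 1] by simp
        then show "(?r powr \<beta> * ln ?r)\<^sup>2 \<le> (1 * ln ?r)\<^sup>2"
          unfolding power_mult_distrib by (intro mult_right_mono power_mono) auto
      qed auto
      also have "\<dots> = (ln (1 / ?r))\<^sup>2" using r by (simp add: ln_div)
      also have "\<dots> \<le> 1 / (1/4)\<^sup>2 * (1 / ?r) powr (2 * (1/4))"
        using that r by (intro ln_sq) auto
      also have "\<dots> = 16 * ?r powr - (1/2)"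
        using r by (simp add: powr_divide powr_minus field_simps power2_eq_square)
      also have "\<dots> \<le> (16 + 1 / e\<^sup>2) * ?r powr - (1/2)"
        by (intro mult_right_mono) auto
      finally show ?thesis .
    qed
    show "?f \<le> (16 + 1 / e\<^sup>2) * ?r powr - (2 * (s - \<beta> - e))" if r: "1 \<le> ?r"
    proof -
      have "?f \<le> ?r powr (- 2 * s) * (?r powr (2 * \<beta>) * (1 / e\<^sup>2 * ?r powr (2 * e)))"
      proof (rule mult_mono)
        have "(1 + ?r\<^sup>2) powr (- s) \<le> (?r\<^sup>2) powr (- s)"
          using s r by (intro powr_mono2') auto
        also have "\<dots> = ?r powr (- 2 * s)"
          using r by (simp add: powr_powr flip: powr_numeral)
        finally show "(1 + ?r\<^sup>2) powr (- s) \<le> ?r powr (- 2 * s)" .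
        have "(?r powr \<beta>)\<^sup>2 = ?r powr (2 * \<beta>)" by (simp add: power2_eq_square flip: powr_add)
        then show "(?r powr \<beta> * ln ?r)\<^sup>2 \<le> ?r powr (2 * \<beta>) * (1 / e\<^sup>2 * ?r powr (2 * e))"
          unfolding power_mult_distrib using mult_left_mono[OF ln_sq[OF r e], of "?r powr (2 * \<beta>)"] by simp
      qed auto
      also have "\<dots> = 1 / e\<^sup>2 * ?r powr - (2 * (s - \<beta> - e))"
        by (simp add: algebra_simps flip: powr_add)
      also have "\<dots> \<le> (16 + 1 / e\<^sup>2) * ?r powr - (2 * (s - \<beta> - e))"
        by (intro mult_right_mono) auto
      finally show ?thesis .
    qed
  qed auto
qed

section \<open>Sobolev norms from pointwise bounds, above everywhere and below on a shell\<close>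

lemma sobolev_norm_le:
  fixes u :: "'n::finite fourier_side" and g :: "real ^ 'n \<Rightarrow> real"
  assumes u: "u \<in> borel_measurable lborel"
    and g: "integrable lborel (\<lambda>\<xi>. (1 + (norm \<xi>)\<^sup>2) powr \<sigma> * (g \<xi>)\<^sup>2)"
    and e: "0 \<le> e" and le: "\<And>\<xi>. cmod (u \<xi>) \<le> e * \<bar>g \<xi>\<bar>"
  shows "sobolev_norm \<sigma> u
    \<le> ennreal (sqrt (LINT \<xi>|lborel. (1 + (norm \<xi>)\<^sup>2) powr \<sigma> * (g \<xi>)\<^sup>2) * e)"
proof -
  note [measurable] = u
  let ?U = "\<lambda>\<xi>. (1 + (norm \<xi>)\<^sup>2) powr \<sigma> * (cmod (u \<xi>))\<^sup>2"
  let ?G = "\<lambda>\<xi>. (1 + (norm \<xi>)\<^sup>2) powr \<sigma> * (g \<xi>)\<^sup>2"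
  have UG: "?U \<xi> \<le> e\<^sup>2 * ?G \<xi>" for \<xi>
  proof -
    have "(cmod (u \<xi>))\<^sup>2 \<le> (e * \<bar>g \<xi>\<bar>)\<^sup>2" using le by (intro power_mono) auto
    also have "\<dots> = e\<^sup>2 * (g \<xi>)\<^sup>2" by (simp add: power_mult_distrib)
    finally have "(1 + (norm \<xi>)\<^sup>2) powr \<sigma> * (cmod (u \<xi>))\<^sup>2 \<le> (1 + (norm \<xi>)\<^sup>2) powr \<sigma> * (e\<^sup>2 * (g \<xi>)\<^sup>2)"
      by (intro mult_left_mono) auto
    then show ?thesis by (simp add: mult_ac)
  qed
  have int: "integrable lborel ?U"
    by (rule Bochner_Integration.integrable_bound[OF integrable_mult_right[OF g, of "e\<^sup>2"]])
       (use UG in auto)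
  have "(LINT \<xi>|lborel. ?U \<xi>) \<le> (LINT \<xi>|lborel. e\<^sup>2 * ?G \<xi>)"
    by (rule integral_mono) (use int g UG in auto)
  then have "sqrt (LINT \<xi>|lborel. ?U \<xi>) \<le> sqrt (e\<^sup>2 * (LINT \<xi>|lborel. ?G \<xi>))"
    by simp
  also have "\<dots> = sqrt (LINT \<xi>|lborel. ?G \<xi>) * e" using e by (simp add: real_sqrt_mult)
  finally show ?thesis using int u by (simp add: sobolev_norm_def ennreal_leI)
qed

text \<open>For s >= 0 the Sobolev weight on the shell is at least 10 powr (- s), as 10 = 1 + 3^2;
  so this bounds the norm of the indicator of the shell from below.\<close>

definition shell_const :: "'n::finite itself \<Rightarrow> real \<Rightarrow> real" where
  "shell_const _ s = sqrt (10 powr (- s) * measure lborel (cball (0 :: real ^ 'n) 3 - ball 0 2))"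

lemma shell_const_pos: "0 < shell_const TYPE('n::finite) s"
proof -
  have "ball (0 :: real ^ 'n) 2 \<subseteq> cball 0 3" by auto
  then have "measure lborel (cball (0 :: real ^ 'n) 3 - ball 0 2)
      = measure lborel (cball (0 :: real ^ 'n) 3) - measure lborel (ball (0 :: real ^ 'n) 2)"
    using emeasure_lborel_cball_finite[of "0 :: real ^ 'n" 3] by (intro measure_Diff) auto
  also have "\<dots> = unit_ball_vol (real CARD('n)) * (3 ^ CARD('n) - 2 ^ CARD('n))"
    by (simp add: content_ball content_cball algebra_simps)
  also have "\<dots> > 0" by (intro mult_pos_pos) (auto intro!: power_strict_mono)
  finally show ?thesis by (simp add: shell_const_def)
qed

lemma sobolev_norm_ge:
  fixes u :: "'n::finite fourier_side"
  assumes s: "0 \<le> s" and c: "0 \<le> c"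
    and ge: "\<And>\<xi>. 2 \<le> norm \<xi> \<Longrightarrow> norm \<xi> \<le> 3 \<Longrightarrow> c \<le> cmod (u \<xi>)"
  shows "ennreal (shell_const TYPE('n) s * c) \<le> sobolev_norm (- s) u"
proof -
  let ?R = "cball (0 :: real ^ 'n) 3 - ball 0 2"
  let ?U = "\<lambda>\<xi>. (1 + (norm \<xi>)\<^sup>2) powr (- s) * (cmod (u \<xi>))\<^sup>2"
  show ?thesis
  \<comment> \<open>Outside the Sobolev space the norm is \<infinity> by definition and the bound is
    trivial.\<close>
  proof (cases "u \<in> borel_measurable lborel \<and> integrable lborel ?U")
    case True
    have fin: "emeasure lborel ?R < \<infinity>"
      by (rule le_less_trans[OF emeasure_mono emeasure_lborel_cball_finite[of 0 3]]) auto
    have "(LINT \<xi>|lborel. indicator ?R \<xi> *\<^sub>R (10 powr (- s) * c\<^sup>2)) \<le> (LINT \<xi>|lborel. ?U \<xi>)"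
    proof (rule integral_mono)
      show "integrable lborel (\<lambda>\<xi>. indicator ?R \<xi> *\<^sub>R (10 powr (- s) * c\<^sup>2))"
        using fin by (intro integrable_scaleR_left integrable_real_indicator) auto
      fix \<xi> :: "real ^ 'n"
      show "indicator ?R \<xi> *\<^sub>R (10 powr (- s) * c\<^sup>2) \<le> ?U \<xi>"
      proof (cases "\<xi> \<in> ?R")
        case R: True
        then have r: "2 \<le> norm \<xi>" "norm \<xi> \<le> 3" by auto
        have "(norm \<xi>)\<^sup>2 \<le> 3\<^sup>2" using r by (intro power_mono) auto
        then have "10 powr (- s) \<le> (1 + (norm \<xi>)\<^sup>2) powr (- s)"
          using s by (intro powr_mono2') (auto simp: add_pos_nonneg)
        moreover have "c\<^sup>2 \<le> (cmod (u \<xi>))\<^sup>2" using ge[OF r] c by (intro power_mono)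
        ultimately show ?thesis using R by (auto intro!: mult_mono)
      qed auto
    qed (use True in auto)
    then have "sqrt (10 powr (- s) * measure lborel ?R * c\<^sup>2) \<le> sqrt (LINT \<xi>|lborel. ?U \<xi>)"
      by (simp add: mult_ac)
    moreover have "sqrt (10 powr (- s) * measure lborel ?R * c\<^sup>2) = shell_const TYPE('n) s * c"
      unfolding shell_const_def using c by (subst real_sqrt_mult) simp
    ultimately show ?thesis using True by (simp add: sobolev_norm_def ennreal_leI)
  next
    case False
    then have "sobolev_norm (- s) u = \<infinity>" unfolding sobolev_norm_def by (rule if_not_P)
    then show ?thesis by simp
  qed
qed

section \<open>Comparison of the kernels\<close>

context volterra_family
begin

text \<open>From 1 - x <= - ln x at x = \<mu>/\<nu>. The logarithm turns the two powers of |xi| into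
  a bound linear in the difference of the exponents.\<close>

lemma S_diff_le_ln:
  assumes "0 < \<mu>" "0 < \<nu>" and t: "0 < t"
  shows "\<bar>S \<mu> t - S \<nu> t\<bar> \<le> \<bar>ln \<nu> - ln \<mu>\<bar>"
proof -
  have *: "\<bar>S \<mu> t - S \<nu> t\<bar> \<le> \<bar>ln \<nu> - ln \<mu>\<bar>" if "0 < \<mu>" "\<mu> \<le> \<nu>" for \<mu> \<nu>
  proof -
    have ge: "0 \<le> S \<mu> t - S \<nu> t" using S_antimono_right[of \<mu> \<nu> t] that t by simp
    have "S \<mu> t - S \<nu> t \<le> (1 - \<mu> / \<nu>) * (1 - S \<nu> t)" by (rule S_diff(2)[OF that t])
    also have "\<dots> \<le> (1 - \<mu> / \<nu>) * 1"
      using S_nonneg[of \<nu> t] that t by (intro mult_left_mono) auto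
    also have "\<dots> \<le> ln \<nu> - ln \<mu>"
      using ln_le_minus_one[of "\<mu> / \<nu>"] that by (simp add: ln_div)
    finally show ?thesis using ge by simp
  qed
  show ?thesis
    using *[of \<mu> \<nu>] *[of \<nu> \<mu>] assms by (cases "\<mu> \<le> \<nu>") (auto simp: abs_minus_commute)
qed

text \<open>Monotonicity in the parameter suffices; \<open>max\<close> confines it to the range
  where monotonicity is known.\<close>

lemma S_borel_measurable:
  assumes "0 < t"
  shows "(\<lambda>\<nu>. S (max \<nu> 0) t) \<in> borel_measurable borel"
proof -
  have "mono (\<lambda>\<nu>. - S (max \<nu> 0) t)"
    using assms by (intro monoI) (auto intro!: S_antimono_right)
  then have "(\<lambda>\<nu>. - S (max \<nu> 0) t) \<in> borel_measurable borel"
    by (rule borel_measurable_mono)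
  then show ?thesis by simp
qed

text \<open>\<open>S_lower\<close> gives S >= k/(k + \<mu>), and k + \<mu> <= c (k + 1) makes this
  uniform for \<mu> <= c. At k = 0 the factor is 0.\<close>

lemma S_ge_k_factor:
  assumes mu: "0 < \<mu>" "\<mu> \<le> c" "1 \<le> c" and t: "0 < t"
  shows "k_factor (k t) / c \<le> S \<mu> t"
proof (cases "k t = 0")
  case True
  then show ?thesis using S_nonneg[of \<mu> t] mu t by (simp add: k_factor_def)
next
  case False
  then have kt: "0 < k t" using k(2)[OF t] by simp
  have "k_factor (k t) / c = k t / (c * (k t + 1))"
    using kt mu by (simp add: k_factor_def field_simps)
  also have "\<dots> \<le> k t / (k t + \<mu>)"
  proof (rule divide_left_mono)
    have "1 * k t \<le> c * k t" using mu kt by (intro mult_right_mono) auto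
    then show "k t + \<mu> \<le> c * (k t + 1)" using mu by (simp add: distrib_left)
  qed (use kt mu in \<open>auto intro!: mult_pos_pos\<close>)
  also have "\<dots> \<le> S \<mu> t"
    using S_lower[OF mu(1) t] kt mu by (simp add: divide_le_eq algebra_simps)
  finally show ?thesis .
qed

lemma one_minus_S_ge:
  assumes nu: "1 \<le> \<nu>" and t: "0 < t"
  shows "A t / (1 + A t) \<le> 1 - S \<nu> t"
proof -
  have A: "0 \<le> A t" by (rule A_nonneg[OF t])
  have "S \<nu> t * A t \<le> \<nu> * S \<nu> t * A t"
    using nu S_nonneg[of \<nu> t] t A by (intro mult_right_mono) (auto simp: mult_le_cancel_right1)
  also have "\<dots> \<le> 1 - S \<nu> t" using S_upper[of \<nu> t] nu t by simp
  finally have "A t \<le> (1 - S \<nu> t) * (1 + A t)" by (simp add: algebra_simps)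
  then show ?thesis using A by (simp add: divide_le_eq)
qed

text \<open>With x = 2 - \<alpha> the factor 1 - \<mu>/\<nu> of \<open>S_diff\<close> is 1 - r^(-x),
  which is at least x/4 for r >= 2; this is the origin of the 4.\<close>

lemma S_powr_diff_ge:
  assumes r: "2 \<le> r" and \<alpha>: "1 < \<alpha>" "\<alpha> < 2" and t: "0 < t"
  shows "(2 - \<alpha>) / 4 * ((1 - S (r powr 2) t) * S (r powr \<alpha>) t) \<le> S (r powr \<alpha>) t - S (r powr 2) t"
proof -
  have le: "r powr \<alpha> \<le> r powr 2" using r \<alpha> by (intro powr_mono) auto
  define x where "x = 2 - \<alpha>"
  have x: "0 < x" "x < 1" using \<alpha> by (auto simp: x_def)
  have "1 + x / 2 \<le> exp (x * ln 2)"
    using exp_ge_add_one_self[of "x * ln 2"] ln2_ge_two_thirds mult_left_mono[of "1/2" "ln 2" x] x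
    by linarith
  also have "\<dots> = 2 powr x" by (simp add: powr_def)
  also have "\<dots> \<le> r powr x" using r x by (intro powr_mono2) auto
  finally have rx: "1 + x / 2 \<le> r powr x" .
  \<comment> \<open>2^x >= 1 + x/2 because ln 2 > 1/2, and (1 - x/4)(1 + x/2) >= 1 on (0, 1); so 1 /
    r^x <= 1 - x/4 without a mean value argument.\<close>
  have "(1 - x / 4) * r powr x \<ge> (1 - x / 4) * (1 + x / 2)"
    using rx x by (intro mult_left_mono) auto
  moreover have "(1 - x / 4) * (1 + x / 2) = 1 + x / 4 * (1 - x / 2)" by (simp add: algebra_simps)
  moreover have "0 \<le> x / 4 * (1 - x / 2)" using x by (intro mult_nonneg_nonneg) auto
  ultimately have "1 \<le> (1 - x / 4) * r powr x" by linarith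
  then have "1 / r powr x \<le> 1 - x / 4"
    using r by (simp add: divide_le_eq)
  moreover have "r powr \<alpha> / r powr 2 = 1 / r powr x"
    using r by (simp add: x_def powr_diff)
  ultimately have "x / 4 \<le> 1 - r powr \<alpha> / r powr 2" by simp
  then have "x / 4 * ((1 - S (r powr 2) t) * S (r powr \<alpha>) t)
      \<le> (1 - r powr \<alpha> / r powr 2) * ((1 - S (r powr 2) t) * S (r powr \<alpha>) t)"
    using S_le_1[of "r powr 2" t] S_nonneg[of "r powr \<alpha>" t] t by (intro mult_right_mono) auto
  also have "\<dots> \<le> S (r powr \<alpha>) t - S (r powr 2) t"
    using S_diff(1)[OF _ le t] r by (simp add: mult.assoc)
  finally show ?thesis by (simp add: x_def)
qed

end

lemma volterra_family_s_gamma: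
  assumes "cond_H \<gamma> m k b"
  shows "volterra_family (m_gamma \<gamma> m) k b (\<lambda>\<nu> t. s_gamma \<gamma> m t \<nu>)"
  using assms unfolding cond_H_def
  by unfold_locales (auto intro: L1_loc_m_gamma volterra_solution_s_gamma)

lemma Q_gamma_measurable:
  assumes "cond_H \<gamma> m k b" "0 < t"
  shows "(Q_gamma \<gamma> m \<alpha> t :: 'n::finite fourier_side) \<in> borel_measurable lborel"
proof -
  interpret volterra_family "m_gamma \<gamma> m" k b "\<lambda>\<nu> t. s_gamma \<gamma> m t \<nu>"
    by (rule volterra_family_s_gamma[OF assms(1)])
  have "(\<lambda>\<xi>::real ^ 'n. s_gamma \<gamma> m t (max (norm \<xi> powr \<alpha>) 0)) \<in> borel_measurable lborel"
    by (rule measurable_compose[OF _ S_borel_measurable[OF assms(2)]]) simp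
  moreover have "max (norm \<xi> powr \<alpha>) 0 = norm \<xi> powr \<alpha>" for \<xi> :: "real ^ 'n"
    by (rule max_absorb1) simp
  ultimately have "(\<lambda>\<xi>::real ^ 'n. s_gamma \<gamma> m t (norm \<xi> powr \<alpha>)) \<in> borel_measurable lborel"
    by (simp only:)
  moreover have "complex_of_real \<in> borel_measurable borel"
    by (intro borel_measurable_continuous_onI continuous_intros)
  ultimately show ?thesis unfolding Q_gamma_def by (rule measurable_compose)
qed

lemma cmod_Q_diff_le:
  assumes H: "cond_H \<gamma> m k b" and t: "0 < t" and \<alpha>: "1 < \<alpha>" "\<alpha> < 2"
  shows "cmod ((Q_gamma \<gamma> m \<alpha> t - Q_gamma \<gamma> m 2 t) \<xi>) \<le> (2 - \<alpha>) * \<bar>ln (norm \<xi>)\<bar>"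
proof (cases "\<xi> = 0")
  \<comment> \<open>Both powers of 0 are 0, so the two kernels agree there.\<close>
  case True
  then show ?thesis by (simp add: Q_gamma_def)
next
  case False
  interpret volterra_family "m_gamma \<gamma> m" k b "\<lambda>\<nu> t. s_gamma \<gamma> m t \<nu>"
    by (rule volterra_family_s_gamma[OF H])
  have "cmod ((Q_gamma \<gamma> m \<alpha> t - Q_gamma \<gamma> m 2 t) \<xi>)
      = \<bar>s_gamma \<gamma> m t (norm \<xi> powr \<alpha>) - s_gamma \<gamma> m t (norm \<xi> powr 2)\<bar>"
    by (simp only: Q_gamma_def minus_apply of_real_diff[symmetric] norm_of_real)
  also have "\<dots> \<le> \<bar>ln (norm \<xi> powr 2) - ln (norm \<xi> powr \<alpha>)\<bar>"
    using False t by (intro S_diff_le_ln) auto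
  also have "ln (norm \<xi> powr 2) - ln (norm \<xi> powr \<alpha>) = (2 - \<alpha>) * ln (norm \<xi>)"
    using False by (simp only: ln_powr left_diff_distrib)
  also have "\<bar>\<dots>\<bar> = (2 - \<alpha>) * \<bar>ln (norm \<xi>)\<bar>" using \<alpha> by (simp add: abs_mult)
  finally show ?thesis .
qed

lemma cmod_Q_diff_ge:
  assumes H: "cond_H \<gamma> m k b" and t: "0 < t" and \<alpha>: "1 < \<alpha>" "\<alpha> < 2" and \<xi>: "2 \<le> norm \<xi>"
  shows "(2 - \<alpha>) / 4 * ((1 - s_gamma \<gamma> m t (norm \<xi> powr 2)) * s_gamma \<gamma> m t (norm \<xi> powr \<alpha>))
    \<le> cmod ((Q_gamma \<gamma> m \<alpha> t - Q_gamma \<gamma> m 2 t) \<xi>)"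
proof -
  interpret volterra_family "m_gamma \<gamma> m" k b "\<lambda>\<nu> t. s_gamma \<gamma> m t \<nu>"
    by (rule volterra_family_s_gamma[OF H])
  have "cmod ((Q_gamma \<gamma> m \<alpha> t - Q_gamma \<gamma> m 2 t) \<xi>)
      = \<bar>s_gamma \<gamma> m t (norm \<xi> powr \<alpha>) - s_gamma \<gamma> m t (norm \<xi> powr 2)\<bar>"
    by (simp only: Q_gamma_def minus_apply of_real_diff[symmetric] norm_of_real)
  then show ?thesis using S_powr_diff_ge[OF \<xi> \<alpha> t] by linarith
qed

text \<open>Parameter ranges independent of \<alpha>: \<open>9\<close> and \<open>4\<close> are the
  squares of the outer and the inner radius.\<close>

lemma powr_in_shell:
  fixes r :: real
  assumes "2 \<le> r" "r \<le> 3" "1 < \<alpha>" "\<alpha> < 2"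
  shows "0 < r powr \<alpha>" "r powr \<alpha> \<le> 9" "4 \<le> r powr 2"
proof -
  have "r powr \<alpha> \<le> r powr 2" using assms by (intro powr_mono) auto
  also have "\<dots> = r\<^sup>2" using assms by simp
  also have "\<dots> \<le> 3\<^sup>2" using assms by (intro power_mono) auto
  finally show "r powr \<alpha> \<le> 9" by simp
  have "2\<^sup>2 \<le> r\<^sup>2" using assms by (intro power_mono) auto
  then show "4 \<le> r powr 2" using assms by simp
qed (use assms in simp)

text \<open>Serves both lower bounds: \<open>u\<close> is the difference with or without the
  fractional Laplacian, and \<open>c\<close> is a bound at one time, uniform over the shell.\<close>

lemma sobolev_norm_Q_diff_ge:
  fixes u :: "'n::finite fourier_side"
  assumes H: "cond_H \<gamma> m k b" and t: "0 < t" and \<alpha>: "1 < \<alpha>" "\<alpha> < 2" and s: "0 \<le> s" and c: "0 \<le> c"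
    and u: "\<And>\<xi>. 2 \<le> norm \<xi> \<Longrightarrow> cmod ((Q_gamma \<gamma> m \<alpha> t - Q_gamma \<gamma> m 2 t) \<xi>) \<le> cmod (u \<xi>)"
    and lower: "\<And>\<mu> \<nu>. 0 < \<mu> \<Longrightarrow> \<mu> \<le> 9 \<Longrightarrow> 4 \<le> \<nu>
      \<Longrightarrow> c \<le> (1 - s_gamma \<gamma> m t \<nu>) * s_gamma \<gamma> m t \<mu>"
  shows "ennreal (shell_const TYPE('n) s / 4 * c * (2 - \<alpha>))
    \<le> sobolev_norm (- s) u"
proof -
  have "ennreal (shell_const TYPE('n) s * ((2 - \<alpha>) / 4 * c)) \<le> sobolev_norm (- s) u"
  proof (rule sobolev_norm_ge[OF s])
    show "0 \<le> (2 - \<alpha>) / 4 * c" using \<alpha> c by auto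
    fix \<xi> :: "real ^ 'n" assume \<xi>: "2 \<le> norm \<xi>" "norm \<xi> \<le> 3"
    have "(2 - \<alpha>) / 4 * c \<le> (2 - \<alpha>) / 4 *
        ((1 - s_gamma \<gamma> m t (norm \<xi> powr 2)) * s_gamma \<gamma> m t (norm \<xi> powr \<alpha>))"
      using powr_in_shell[OF \<xi> \<alpha>] \<alpha> by (intro mult_left_mono lower) auto
    also have "\<dots> \<le> cmod ((Q_gamma \<gamma> m \<alpha> t - Q_gamma \<gamma> m 2 t) \<xi>)"
      by (rule cmod_Q_diff_ge[OF H t \<alpha> \<xi>(1)])
    also have "\<dots> \<le> cmod (u \<xi>)" by (rule u[OF \<xi>(1)])
    finally show "(2 - \<alpha>) / 4 * c \<le> cmod (u \<xi>)" .
  qed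
  then show ?thesis by (simp add: mult_ac)
qed

theorem lemma4p2:
  fixes s \<beta> :: real
  assumes "s > real CARD('n::finite) / 2"
    and "0 \<le> \<beta>" and "\<beta> < s - real CARD('n) / 2"
  shows "\<exists>A>0. \<exists>A'>0. \<forall>\<gamma>>0. \<forall>m k b. cond_H \<gamma> m k b \<longrightarrow>
    (\<forall>\<alpha>\<in>{1<..<2}. \<forall>t>0.
       sobolev_norm (- s) (frac_laplacian \<beta>
         (Q_gamma \<gamma> m \<alpha> t - Q_gamma \<gamma> m 2 t :: 'n fourier_side))
         \<le> ennreal (A * (2 - \<alpha>)) \<and>
       sobolev_norm (- s) (frac_laplacian \<beta>
         (Q_gamma \<gamma> m \<alpha> t - Q_gamma \<gamma> m 2 t :: 'n fourier_side))
         \<ge> ennreal (A' * k_factor (k t)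
              * (conv (\<lambda>_. 1) (m_gamma \<gamma> m) t / (1 + conv (\<lambda>_. 1) (m_gamma \<gamma> m) t))
              * (2 - \<alpha>))) \<and>
    (\<exists>A''\<in>{0<..<A'}. \<forall>\<alpha>\<in>{1<..<2}.
       ennreal (A'' * (2 - \<alpha>))
         \<le> (SUP t\<in>{0<..}. sobolev_norm (- s)
               (Q_gamma \<gamma> m \<alpha> t - Q_gamma \<gamma> m 2 t :: 'n fourier_side)) \<and>
       (SUP t\<in>{0<..}. sobolev_norm (- s)
               (Q_gamma \<gamma> m \<alpha> t - Q_gamma \<gamma> m 2 t :: 'n fourier_side))
         \<le> ennreal (A * (2 - \<alpha>)))"
proof -
  have s: "0 \<le> s" using assms(1) by (meson divide_nonneg_nonneg less_imp_le of_nat_0_le_iff order_trans zero_le_numeral)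
  define N where "N = (\<lambda>b. sqrt (LINT \<xi>::real ^ 'n|lborel.
    (1 + (norm \<xi>)\<^sup>2) powr (- s) * (norm \<xi> powr b * ln (norm \<xi>))\<^sup>2))"
  have int: "integrable lborel (\<lambda>\<xi>::real ^ 'n.
      (1 + (norm \<xi>)\<^sup>2) powr (- s) * (norm \<xi> powr b * ln (norm \<xi>))\<^sup>2)"
    if "b \<in> {0, \<beta>}" for b
    using that assms by (intro integrable_sobolev_weight_ln) auto
  have N: "0 \<le> N b" for b unfolding N_def by (intro real_sqrt_ge_zero Bochner_Integration.integral_nonneg) auto
  \<comment> \<open>One constant for the exponents \<beta> and 0, the latter for the supremum; the 1
    makes it positive. \<open>A\<close> and \<open>A'\<close> depend on the dimension, s and \<beta>
    at most, so they precede \<gamma> and m.\<close>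
  define A where "A = N 0 + N \<beta> + 1"
  \<comment> \<open>36 = 4 * 9, from \<open>S_powr_diff_ge\<close> and from
    \<open>S_ge_k_factor\<close> with c = 9.\<close>
  define A' where "A' = shell_const TYPE('n) s / 36"
  have A: "0 < A" using N[of 0] N[of \<beta>] by (simp add: A_def)
  have A': "0 < A'" using shell_const_pos[where 'n='n] by (simp add: A'_def)
  have "(\<forall>\<alpha>\<in>{1<..<2}. \<forall>t>0.
       sobolev_norm (- s) (frac_laplacian \<beta>
         (Q_gamma \<gamma> m \<alpha> t - Q_gamma \<gamma> m 2 t :: 'n fourier_side))
         \<le> ennreal (A * (2 - \<alpha>)) \<and>
       sobolev_norm (- s) (frac_laplacian \<beta>
         (Q_gamma \<gamma> m \<alpha> t - Q_gamma \<gamma> m 2 t :: 'n fourier_side))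
         \<ge> ennreal (A' * k_factor (k t)
              * (conv (\<lambda>_. 1) (m_gamma \<gamma> m) t / (1 + conv (\<lambda>_. 1) (m_gamma \<gamma> m) t))
              * (2 - \<alpha>))) \<and>
    (\<exists>A''\<in>{0<..<A'}. \<forall>\<alpha>\<in>{1<..<2}.
       ennreal (A'' * (2 - \<alpha>))
         \<le> (SUP t\<in>{0<..}. sobolev_norm (- s)
               (Q_gamma \<gamma> m \<alpha> t - Q_gamma \<gamma> m 2 t :: 'n fourier_side)) \<and>
       (SUP t\<in>{0<..}. sobolev_norm (- s)
               (Q_gamma \<gamma> m \<alpha> t - Q_gamma \<gamma> m 2 t :: 'n fourier_side))
         \<le> ennreal (A * (2 - \<alpha>)))"
    if H: "cond_H \<gamma> m k b" for \<gamma> m k b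
  proof -
    interpret volterra_family "m_gamma \<gamma> m" k b "\<lambda>\<nu> t. s_gamma \<gamma> m t \<nu>"
      by (rule volterra_family_s_gamma[OF H])
    let ?D = "\<lambda>\<alpha> t. Q_gamma \<gamma> m \<alpha> t - Q_gamma \<gamma> m 2 t :: 'n fourier_side"
    have meas: "?D \<alpha> t \<in> borel_measurable lborel" if "0 < t" for \<alpha> t
      using Q_gamma_measurable[OF H that, of \<alpha>] Q_gamma_measurable[OF H that, of 2]
      unfolding fun_diff_def by measurable
    have upper: "sobolev_norm (- s) (?D \<alpha> t) \<le> ennreal (A * (2 - \<alpha>))"
      "sobolev_norm (- s) (frac_laplacian \<beta> (?D \<alpha> t)) \<le> ennreal (A * (2 - \<alpha>))"
      if \<alpha>: "1 < \<alpha>" "\<alpha> < 2" and t: "0 < t" for \<alpha> t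
    proof -
      have le: "cmod (?D \<alpha> t \<xi>) \<le> (2 - \<alpha>) * \<bar>ln (norm \<xi>)\<bar>" for \<xi>
        by (rule cmod_Q_diff_le[OF H t \<alpha>])
      \<comment> \<open>\<open>norm \<xi> powr 0\<close> is 0 at the origin; the bound survives
        because \<open>ln 0 = 0\<close> and \<open>le\<close> already forces the difference to
        vanish there.\<close>
      have "cmod (?D \<alpha> t \<xi>) \<le> (2 - \<alpha>) * \<bar>norm \<xi> powr 0 * ln (norm \<xi>)\<bar>" for \<xi>
        using le[of \<xi>] by (cases "\<xi> = 0") auto
      then have "sobolev_norm (- s) (?D \<alpha> t) \<le> ennreal (N 0 * (2 - \<alpha>))"
        unfolding N_def using \<alpha> by (intro sobolev_norm_le int meas t) auto
      also have "\<dots> \<le> ennreal (A * (2 - \<alpha>))"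
        using N[of \<beta>] \<alpha> by (intro ennreal_leI mult_right_mono) (auto simp: A_def)
      finally show "sobolev_norm (- s) (?D \<alpha> t) \<le> ennreal (A * (2 - \<alpha>))" .
      have "cmod (frac_laplacian \<beta> (?D \<alpha> t) \<xi>) \<le> (2 - \<alpha>) * \<bar>norm \<xi> powr \<beta> * ln (norm \<xi>)\<bar>" for \<xi>
        using mult_left_mono[OF le[of \<xi>], of "norm \<xi> powr \<beta>"]
        by (simp add: frac_laplacian_def norm_mult abs_mult mult.left_commute)
      moreover have "frac_laplacian \<beta> (?D \<alpha> t) \<in> borel_measurable lborel"
        using meas[OF t, of \<alpha>] unfolding frac_laplacian_def by measurable
      ultimately have "sobolev_norm (- s) (frac_laplacian \<beta> (?D \<alpha> t)) \<le> ennreal (N \<beta> * (2 - \<alpha>))"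
        unfolding N_def using \<alpha> by (intro sobolev_norm_le int) auto
      also have "\<dots> \<le> ennreal (A * (2 - \<alpha>))"
        using N[of 0] \<alpha> by (intro ennreal_leI mult_right_mono) (auto simp: A_def)
      finally show "sobolev_norm (- s) (frac_laplacian \<beta> (?D \<alpha> t)) \<le> ennreal (A * (2 - \<alpha>))" .
    qed
    have lower: "ennreal (A' * k_factor (k t)
              * (conv (\<lambda>_. 1) (m_gamma \<gamma> m) t / (1 + conv (\<lambda>_. 1) (m_gamma \<gamma> m) t)) * (2 - \<alpha>))
         \<le> sobolev_norm (- s) (frac_laplacian \<beta> (?D \<alpha> t))"
      if \<alpha>: "1 < \<alpha>" "\<alpha> < 2" and t: "0 < t" for \<alpha> t
    proof -
      let ?A = "conv (\<lambda>_. 1) (m_gamma \<gamma> m) t"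
      define c where "c = (?A / (1 + ?A)) * (k_factor (k t) / 9)"
      have kf: "0 \<le> k_factor (k t)" using k(2)[OF t] by (simp add: k_factor_def)
      have A0: "0 \<le> ?A / (1 + ?A)" using A_nonneg[OF t] by simp
      have "ennreal (shell_const TYPE('n) s / 4 * c * (2 - \<alpha>))
          \<le> sobolev_norm (- s) (frac_laplacian \<beta> (?D \<alpha> t))"
      proof (rule sobolev_norm_Q_diff_ge[OF H t \<alpha> s])
        show "0 \<le> c" unfolding c_def by (intro mult_nonneg_nonneg A0) (use kf in simp)
        show "cmod (?D \<alpha> t \<xi>) \<le> cmod (frac_laplacian \<beta> (?D \<alpha> t) \<xi>)" if "2 \<le> norm \<xi>" for \<xi>
        proof -
          have "1 \<le> norm \<xi> powr \<beta>" using that assms(2) by (intro ge_one_powr_ge_zero) auto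
          then show ?thesis
            using mult_right_mono[of 1 "norm \<xi> powr \<beta>" "cmod (?D \<alpha> t \<xi>)"]
            by (simp add: frac_laplacian_def norm_mult)
        qed
        show "c \<le> (1 - s_gamma \<gamma> m t \<nu>) * s_gamma \<gamma> m t \<mu>" if "0 < \<mu>" "\<mu> \<le> 9" "4 \<le> \<nu>" for \<mu> \<nu>
          unfolding c_def using that t A0 kf S_le_1[of \<nu> t]
          by (intro mult_mono one_minus_S_ge S_ge_k_factor) auto
      qed
      also have "shell_const TYPE('n) s / 4 * c * (2 - \<alpha>) = A' * k_factor (k t) * (?A / (1 + ?A)) * (2 - \<alpha>)"
        by (simp add: c_def A'_def)
      finally show ?thesis .
    qed
    \<comment> \<open>By monotonicity in the parameter, S at 9 and 1 - S at 4 bound these quantities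
      from below on the whole shell.\<close>
    obtain t0 where t0: "0 < t0" "0 < s_gamma \<gamma> m t0 9" "s_gamma \<gamma> m t0 4 < 1"
      by (rule S_nontrivial[of 9 4]) auto
    define c where "c = (1 - s_gamma \<gamma> m t0 4) * s_gamma \<gamma> m t0 9"
    \<comment> \<open>The half enforces \<open>A'' < A'\<close>. Through \<open>t0\<close> and
      \<open>c\<close> this constant may depend on \<gamma> and m.\<close>
    define A'' where "A'' = min (A' / 2) (shell_const TYPE('n) s / 4 * c)"
    have c: "0 < c" using t0 by (simp add: c_def)
    have A'': "A'' \<in> {0<..<A'}"
      using A' c shell_const_pos[where 'n='n] by (auto simp: A''_def min_def)
    have "ennreal (A'' * (2 - \<alpha>)) \<le> (SUP t\<in>{0<..}. sobolev_norm (- s) (?D \<alpha> t))"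
      if \<alpha>: "1 < \<alpha>" "\<alpha> < 2" for \<alpha>
    proof -
      have "ennreal (A'' * (2 - \<alpha>)) \<le> ennreal (shell_const TYPE('n) s / 4 * c * (2 - \<alpha>))"
        using \<alpha> by (intro ennreal_leI mult_right_mono) (auto simp: A''_def)
      also have "\<dots> \<le> sobolev_norm (- s) (?D \<alpha> t0)"
      proof (rule sobolev_norm_Q_diff_ge[OF H t0(1) \<alpha> s])
        show "c \<le> (1 - s_gamma \<gamma> m t0 \<nu>) * s_gamma \<gamma> m t0 \<mu>" if "0 < \<mu>" "\<mu> \<le> 9" "4 \<le> \<nu>" for \<mu> \<nu>
          unfolding c_def using that t0 S_antimono_right[of 4 \<nu> t0] S_antimono_right[of \<mu> 9 t0]
          by (intro mult_mono) auto
      qed (use c in auto)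
      also have "\<dots> \<le> (SUP t\<in>{0<..}. sobolev_norm (- s) (?D \<alpha> t))"
        using t0 by (intro SUP_upper) auto
      finally show ?thesis .
    qed
    moreover have "(SUP t\<in>{0<..}. sobolev_norm (- s) (?D \<alpha> t)) \<le> ennreal (A * (2 - \<alpha>))"
      if "1 < \<alpha>" "\<alpha> < 2" for \<alpha>
      using upper(1) that by (intro SUP_least) auto
    ultimately show ?thesis
      using A'' upper(2) lower by (intro conjI bexI[of _ A''] ballI allI impI) auto
  qed
  then show ?thesis
    using A A' by (intro exI[of _ A] exI[of _ A'] conjI allI impI) auto
qed

end
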